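(* Assume (C1) and (C2). Then problem (P) has a sign-changing solution $u_0\in\mathcal{M}$ (that is, $u_0$ is a critical point of $I$ on $\mathcal{D}$ with $u_0^+\neq 0$ and $u_0^-\neq 0$) such that $$I(u_0)=\inf_{u\in\mathcal{M}}I(u)=:m_*>0,$$ and $u_0$ changes sign only once.
   Context: Fix real numbers $p,q,r$ with $1<p<q$, $\frac{p}{2}$ a positive integer, and $r\ge 1$, and functions $a,b,c:\mathbb{Z}\to(0,+\infty)$. Conditions: - (C1) There is $b_0>0$ with $b(n)\ge b_0$ for all $n\in\mathbb{Z}$ and $\lim_{|n|\to\infty}b(n)=+\infty$. - (C2) There is $c_0>0$ with $c(n)\le c_0$ for all $n\in\mathbb{Z}$ and $\sum_{n\in\mathbb{Z}}c(n)<+\infty$. Notation for a real sequence $u=(u(n))_{n\in\mathbb{Z}}$: $\Delta u(n)=u(n+1)-u(n)$, $u^+(n)=\max\{u(n),0\}$, $u^-(n)=\min\{u(n),0\}$, and $\varphi_p(s)=|s|^{p-2}s$. Spaces: - $E$ is the set of real sequences $u$ with $\|u\|:=\big(\sum_{n\in\mathbb{Z}}[a(n)|\Delta u(n)|^p+b(n)|u(n)|^p]\big)^{1/p}<\infty$. - $\mathcal{D}=\{u\in E:\sum_{n\in\mathbb{Z}}c(n)|u(n)|^q\ln|u(n)|^r<+\infty\}$, where terms with $u(n)=0$ are read as $0$. It carries the norm $\|\cdot\|$. For $u,v\in\mathcal{D}$: - $I(u)=\frac1p\|u\|^p+\frac{r}{q^2}\sum_{n}c(n)|u(n)|^q-\frac1q\sum_{n}c(n)|u(n)|^q\ln|u(n)|^r$.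 - $\langle I'(u),v\rangle=\sum_n\big[a(n)|\Delta u(n)|^{p-2}\Delta u(n)\Delta v(n)+b(n)|u(n)|^{p-2}u(n)v(n)\big]-\sum_n c(n)|u(n)|^{q-2}u(n)v(n)\ln|u(n)|^r$. Sets: - $\mathcal{N}=\{u\in\mathcal{D}:u\neq0,\ \langle I'(u),u\rangle=0\}$. - $\mathcal{M}=\{u\in\mathcal{D}:u^+\ne0,\ u^-\neq0,\ \langle I'(u),u^+\rangle=0,\ \langle I'(u),u^-\rangle=0\}$. Problem (P) is $$-\Delta\big(a(n-1)\varphi_p(\Delta u(n-1))\big)+b(n)\varphi_p(u(n))=c(n)|u(n)|^{q-2}u(n)\ln|u(n)|^r,\quad n\in\mathbb{Z},$$ together with $\lim_{|n|\to\infty}u(n)=0$. A solution of (P) means a critical point of $I$ in $\mathcal{D}$, i.e. $u\in\mathcal{D}$ with $\langle I'(u),v\rangle=0$ for all $v\in\mathcal{D}$. *)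

theory Defs
  imports "HOL-Analysis.Analysis"
begin

definition fdiff :: "(int \<Rightarrow> real) \<Rightarrow> int \<Rightarrow> real" where
  "fdiff u n = u (n + 1) - u n"

definition pos_part :: "(int \<Rightarrow> real) \<Rightarrow> int \<Rightarrow> real" where
  "pos_part u = (\<lambda>n. max (u n) 0)"

definition neg_part :: "(int \<Rightarrow> real) \<Rightarrow> int \<Rightarrow> real" where
  "neg_part u = (\<lambda>n. min (u n) 0)"

definition norm_term :: "real \<Rightarrow> (int \<Rightarrow> real) \<Rightarrow> (int \<Rightarrow> real) \<Rightarrow> (int \<Rightarrow> real) \<Rightarrow> int \<Rightarrow> real" where
  "norm_term p a b u n = a n * \<bar>fdiff u n\<bar> powr p + b n * \<bar>u n\<bar> powr p"

definition normp :: "real \<Rightarrow> (int \<Rightarrow> real) \<Rightarrow> (int \<Rightarrow> real) \<Rightarrow> (int \<Rightarrow> real) \<Rightarrow> real" where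
  "normp p a b u = (\<Sum>\<^sub>\<infinity>n\<in>UNIV. norm_term p a b u n)"

definition Espace :: "real \<Rightarrow> (int \<Rightarrow> real) \<Rightarrow> (int \<Rightarrow> real) \<Rightarrow> (int \<Rightarrow> real) set" where
  "Espace p a b = {u. norm_term p a b u summable_on UNIV}"

definition log_term :: "real \<Rightarrow> real \<Rightarrow> (int \<Rightarrow> real) \<Rightarrow> (int \<Rightarrow> real) \<Rightarrow> int \<Rightarrow> real" where
  "log_term q r c u n = (if u n = 0 then 0 else c n * \<bar>u n\<bar> powr q * ln (\<bar>u n\<bar> powr r))"

definition Dspace :: "real \<Rightarrow> real \<Rightarrow> real \<Rightarrow> (int \<Rightarrow> real) \<Rightarrow> (int \<Rightarrow> real) \<Rightarrow> (int \<Rightarrow> real)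
    \<Rightarrow> (int \<Rightarrow> real) set" where
  "Dspace p q r a b c = {u \<in> Espace p a b. log_term q r c u summable_on UNIV}"

definition Ifun :: "real \<Rightarrow> real \<Rightarrow> real \<Rightarrow> (int \<Rightarrow> real) \<Rightarrow> (int \<Rightarrow> real) \<Rightarrow> (int \<Rightarrow> real)
    \<Rightarrow> (int \<Rightarrow> real) \<Rightarrow> real" where
  "Ifun p q r a b c u =
     normp p a b u / p
     + r / q\<^sup>2 * (\<Sum>\<^sub>\<infinity>n\<in>UNIV. c n * \<bar>u n\<bar> powr q)
     - (\<Sum>\<^sub>\<infinity>n\<in>UNIV. log_term q r c u n) / q"

definition dI :: "real \<Rightarrow> real \<Rightarrow> real \<Rightarrow> (int \<Rightarrow> real) \<Rightarrow> (int \<Rightarrow> real) \<Rightarrow> (int \<Rightarrow> real)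
    \<Rightarrow> (int \<Rightarrow> real) \<Rightarrow> (int \<Rightarrow> real) \<Rightarrow> real" where
  "dI p q r a b c u v =
     (\<Sum>\<^sub>\<infinity>n\<in>UNIV. a n * \<bar>fdiff u n\<bar> powr (p - 2) * fdiff u n * fdiff v n
                    + b n * \<bar>u n\<bar> powr (p - 2) * u n * v n)
     - (\<Sum>\<^sub>\<infinity>n\<in>UNIV. (if u n = 0 then 0 else
                      c n * \<bar>u n\<bar> powr (q - 2) * u n * v n * ln (\<bar>u n\<bar> powr r)))"

definition Nehari :: "real \<Rightarrow> real \<Rightarrow> real \<Rightarrow> (int \<Rightarrow> real) \<Rightarrow> (int \<Rightarrow> real) \<Rightarrow> (int \<Rightarrow> real)
    \<Rightarrow> (int \<Rightarrow> real) set" where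
  "Nehari p q r a b c = {u \<in> Dspace p q r a b c. u \<noteq> (\<lambda>_. 0) \<and> dI p q r a b c u u = 0}"

definition signNehari :: "real \<Rightarrow> real \<Rightarrow> real \<Rightarrow> (int \<Rightarrow> real) \<Rightarrow> (int \<Rightarrow> real) \<Rightarrow> (int \<Rightarrow> real)
    \<Rightarrow> (int \<Rightarrow> real) set" where
  "signNehari p q r a b c = {u \<in> Dspace p q r a b c.
      pos_part u \<noteq> (\<lambda>_. 0) \<and> neg_part u \<noteq> (\<lambda>_. 0) \<and>
      dI p q r a b c u (pos_part u) = 0 \<and> dI p q r a b c u (neg_part u) = 0}"

definition is_solution :: "real \<Rightarrow> real \<Rightarrow> real \<Rightarrow> (int \<Rightarrow> real) \<Rightarrow> (int \<Rightarrow> real) \<Rightarrow> (int \<Rightarrow> real)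
    \<Rightarrow> (int \<Rightarrow> real) \<Rightarrow> bool" where
  "is_solution p q r a b c u \<longleftrightarrow>
     u \<in> Dspace p q r a b c \<and> (\<forall>v \<in> Dspace p q r a b c. dI p q r a b c u v = 0)"

(* u changes sign exactly once: nonnegative up to some index and nonpositive afterwards,
   or vice versa (together with u^+ <> 0 and u^- <> 0 this means exactly one sign change) *)
definition changes_sign_once :: "(int \<Rightarrow> real) \<Rightarrow> bool" where
  "changes_sign_once u \<longleftrightarrow>
     (\<exists>k. ((\<forall>n\<le>k. u n \<ge> 0) \<and> (\<forall>n>k. u n \<le> 0)) \<or> ((\<forall>n\<le>k. u n \<le> 0) \<and> (\<forall>n>k. u n \<ge> 0)))"

end

theory Submission
  imports Defs
begin

text \<open>
  Write \<open>u\<close> as a sum of pieces \<open>u\<^sub>i\<close> separated by sign changes. By Jensen's inequality the \<open>p\<close>-energy of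
  \<open>\<Sum> s\<^sub>i u\<^sub>i\<close> is at most \<open>\<Sum> s\<^sub>i\<^sup>p \<langle>K'(u), u\<^sub>i\<rangle>\<close>, while the logarithmic part splits exactly. If
  \<open>\<langle>I'(u), u\<^sub>i\<rangle> = 0\<close> for all \<open>i\<close>, the elementary inequalities \<open>y - y ln y \<le> 1\<close> and
  \<open>(s\<^sup>p - 1) / p \<le> (s\<^sup>q - 1) / q\<close> give \<open>I(\<Sum> s\<^sub>i u\<^sub>i) \<le> I(u)\<close>, strictly unless all \<open>s\<^sub>i\<close> are 1.

  For every sign-changing \<open>u\<close> the map \<open>(s, t) \<mapsto> I(s u\<^sup>+ + t u\<^sup>-)\<close> has an interior maximum, which
  produces a point of \<open>\<M>\<close>. A minimizing sequence has a pointwise limit \<open>v\<close>; since \<open>c\<close> is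
  summable, \<open>I\<close> is lower semicontinuous along it, and comparing \<open>s v\<^sup>+ + t v\<^sup>- \<in> \<M>\<close> with
  the rescaled sequence shows that the infimum is attained. A perturbation at a single site shows that the
  minimizer solves the equation at each site, and finitely supported sequences are dense. With two sign changes one could
  discard a piece of the minimizer and strictly lower the energy.
\<close>

section \<open>Even powers, logarithms and infinite sums\<close>

text \<open>The obstacle is the difference term: it couples \<open>u\<^sup>+\<close> and
  \<open>u\<^sup>-\<close> at every sign change, so the fibering energy is not a sum of one-variable
  functions and the two constraints defining \<open>M\<close> interact. The coupling is never
  computed. It is enclosed between two bounds with separated variables: from above by Jensen, where
  the coefficients are exactly the quantities occurring in the constraints, and from below by
  superadditivity of even powers, because the differences of \<open>u\<^sup>+\<close> and
  \<open>u\<^sup>-\<close> never have opposite signs. The logarithmic condition in the definition of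
  the domain holds throughout \<open>E\<close>: finite energy bounds a sequence, and
  \<open>c\<close> is summable. The same majorant makes the logarithmic terms continuous under
  bounded pointwise convergence. \<open>J\<close> is never differentiated as a functional on
  \<open>E\<close>. Derivatives are taken only in one real variable, either a scale factor or the
  value at one site. Hence no smoothness of \<open>M\<close>, no Lagrange multiplier and no
  deformation argument is needed. Mass cannot escape to infinity: where
  \<open>\<bar>u n\<bar>\<close> exceeds 1, \<open>b n\<close> is at most the energy, and this
  confines such sites to a fixed finite set.\<close>

lemma even_power_above_tangent:
  fixes x h :: real
  assumes "even P"
  shows "x ^ P + real P * h * x ^ (P - 1) \<le> (x + h) ^ P"
proof -
  have d: "((\<lambda>x. x ^ P) has_real_derivative real P * x ^ (P - 1)) (at x within UNIV)"
    using DERIV_pow[of P x UNIV] by simp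
  have "real P * x ^ (P - 1) * ((x + h) - x) \<le> (x + h) ^ P - x ^ P"
    using convex_on_imp_above_tangent[OF convex_power_even[OF assms] connected_UNIV _ UNIV_I d]
    by (simp only: interior_UNIV UNIV_I)
  then show ?thesis by (simp add: mult_ac)
qed

text \<open>Jensen's inequality with weights \<open>x / (x - y)\<close> and \<open>- y / (x - y)\<close>.\<close>

lemma even_power_weighted_aux:
  fixes x y s t :: real
  assumes "even P" "P \<ge> 1" "0 \<le> x" "y \<le> 0"
  shows "(s * x - t * y) ^ P \<le> (x - y) ^ (P - 1) * (s ^ P * x - t ^ P * y)"
proof (cases "x - y = 0")
  case True
  then have "x = 0" "y = 0" using assms by auto
  then show ?thesis using assms by (simp add: power_0_left)
next
  case False
  define X where "X = x - y"
  have X: "X > 0" using False assms by (auto simp: X_def)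
  have XP: "X ^ P = X ^ (P - 1) * X"
    using assms(2) by (metis One_nat_def Suc_pred less_eq_Suc_le mult.commute power_Suc)
  have sum1: "x / X + (- y / X) = 1"
    using X by (simp add: X_def diff_divide_distrib[symmetric])
  have "0 \<le> x / X" "0 \<le> - y / X"
    using X assms by (auto intro: divide_nonneg_pos divide_nonpos_pos)
  then have "((x / X) *\<^sub>R s + (- y / X) *\<^sub>R t) ^ P \<le> (x / X) * s ^ P + (- y / X) * t ^ P"
    using convex_power_even[OF assms(1)] sum1 unfolding convex_on_def by blast
  then have "((x / X) * s + (- y / X) * t) ^ P \<le> (x / X) * s ^ P + (- y / X) * t ^ P" by simp
  then have "X ^ P * ((x / X) * s + (- y / X) * t) ^ P \<le> X ^ P * ((x / X) * s ^ P + (- y / X) * t ^ P)"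
    using X by (intro mult_left_mono) auto
  moreover have "X ^ P * ((x / X) * s + (- y / X) * t) ^ P = (s * x - t * y) ^ P"
  proof -
    have "(x / X) * s + (- y / X) * t = (s * x - t * y) / X" using X by (simp add: field_simps)
    then show ?thesis using X by (simp add: power_divide)
  qed
  moreover have "X ^ P * ((x / X) * s ^ P + (- y / X) * t ^ P) = X ^ (P - 1) * (s ^ P * x - t ^ P * y)"
    unfolding XP using X by (simp add: field_simps)
  ultimately show ?thesis by (simp add: X_def)
qed

text \<open>The estimate for a single edge: with \<open>x = u (n + 1)\<close> and
  \<open>y = u n\<close>, the right side is the derivative of the edge energy in the direction
  scaled by \<open>P\<close>-th powers. Equal factors give equality. For opposite signs in the
  reverse order, negate \<open>x\<close> and \<open>y\<close>: the even power is unchanged and the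
  odd power \<open>P - 1\<close> supplies a sign that cancels.\<close>

lemma even_power_weighted:
  fixes x y s t :: real
  assumes "even P" "P \<ge> 1" "s = t \<or> x * y \<le> 0"
  shows "(s * x - t * y) ^ P \<le> (x - y) ^ (P - 1) * (s ^ P * x - t ^ P * y)"
proof (cases "s = t")
  case True
  have "(x - y) ^ (P - 1) * (t ^ P * x - t ^ P * y) = t ^ P * ((x - y) ^ (P - 1) * (x - y))"
    by (simp add: algebra_simps)
  also have "\<dots> = t ^ P * (x - y) ^ P"
    using assms(2) by (metis One_nat_def Suc_pred less_eq_Suc_le mult.commute power_Suc)
  also have "\<dots> = (s * x - t * y) ^ P"
    using True by (simp add: power_mult_distrib[symmetric] right_diff_distrib)
  finally show ?thesis using True by simp
next
  case False
  then consider "0 \<le> x \<and> y \<le> 0" | "0 \<le> - x \<and> - y \<le> 0"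
    using assms(3) by (auto simp: mult_le_0_iff)
  then show ?thesis
  proof cases
    case 1
    then show ?thesis using even_power_weighted_aux[OF assms(1,2)] by blast
  next
    case 2
    have e: "(- z) ^ P = z ^ P" for z :: real using assms(1) by simp
    have o: "(- z) ^ (P - 1) = - (z ^ (P - 1))" for z :: real
      using assms(1,2) by (simp add: power_minus_odd)
    have "(s * - x - t * - y) ^ P \<le> (- x - - y) ^ (P - 1) * (s ^ P * - x - t ^ P * - y)"
      using even_power_weighted_aux[OF assms(1,2), of "- x" "- y" s t] 2 by blast
    also have "(s * - x - t * - y) ^ P = (s * x - t * y) ^ P"
      using e[of "s * x - t * y"] by (simp add: algebra_simps)
    also have "(- x - - y) ^ (P - 1) = - ((x - y) ^ (P - 1))"
      using o[of "x - y"] by (simp add: algebra_simps)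
    finally show ?thesis by (simp add: algebra_simps)
  qed
qed

text \<open>A crude Young inequality, obtained by replacing both factors by the larger one. It
  provides the summable majorant for the mixed terms of \<open>dkin\<close>.\<close>

lemma abs_power_mult_le:
  fixes x y :: real
  assumes "even P" "P \<ge> 1"
  shows "\<bar>x ^ (P - 1) * y\<bar> \<le> x ^ P + y ^ P"
proof -
  define M where "M = max \<bar>x\<bar> \<bar>y\<bar>"
  have "\<bar>x ^ (P - 1) * y\<bar> = \<bar>x\<bar> ^ (P - 1) * \<bar>y\<bar>" by (simp add: abs_mult power_abs)
  also have "\<dots> \<le> M ^ (P - 1) * M" by (intro mult_mono power_mono) (auto simp: M_def)
  also have "\<dots> = M ^ P"
    using assms(2) by (metis One_nat_def Suc_pred less_eq_Suc_le mult.commute power_Suc)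
  also have "\<dots> \<le> \<bar>x\<bar> ^ P + \<bar>y\<bar> ^ P" by (auto simp: M_def max_def)
  finally show ?thesis using assms(1) by (simp add: power_even_abs)
qed

lemma even_power_superadditive:
  fixes x y :: real
  assumes "even P" "P \<ge> 1" "x * y \<ge> 0"
  shows "x ^ P + y ^ P \<le> (x + y) ^ P"
proof -
  have pos: "u ^ P + v ^ P \<le> (u + v) ^ P" if "u \<ge> 0" "v \<ge> 0" for u v :: real
  proof -
    have Suc: "z ^ P = z ^ (P - 1) * z" for z :: real
      using assms(2) by (metis One_nat_def Suc_pred less_eq_Suc_le mult.commute power_Suc)
    have "u ^ P + v ^ P \<le> (u + v) ^ (P - 1) * u + (u + v) ^ (P - 1) * v"
      unfolding Suc using that by (intro add_mono mult_right_mono power_mono) auto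
    also have "\<dots> = (u + v) ^ P" unfolding Suc by (simp add: algebra_simps)
    finally show ?thesis .
  qed
  from assms(3) have "\<bar>x + y\<bar> = \<bar>x\<bar> + \<bar>y\<bar>" by (auto simp: zero_le_mult_iff)
  then show ?thesis using pos[of "\<bar>x\<bar>" "\<bar>y\<bar>"] assms(1) by (simp add: power_even_abs flip: power_even_abs[of P "x+y"])
qed

section \<open>Scalar inequalities and continuity for powers and logarithms\<close>

lemma power_diff_quotient_le:
  fixes s q :: real
  assumes "s \<ge> 0" "P \<ge> 1" "real P < q"
  shows "(s ^ P - 1) / real P \<le> (s powr q - 1) / q"
proof (cases "s = 0")
  case True
  then show ?thesis using assms by (auto simp: field_simps power_0_left)
next
  case False
  then have s: "s > 0" using assms by auto
  have q: "q > 0" using assms by linarith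
  \<comment> \<open>In terms of \<open>y\<close> the claim is Bernoulli's inequality
    \<open>y powr k \<ge> 1 + k * (y - 1)\<close> for \<open>k = q / P > 1\<close>, that is,
    convexity compared with the tangent at 1.\<close>
  define y where "y = s ^ P"
  have y: "y > 0" using s by (simp add: y_def)
  define k where "k = q / real P"
  have k: "k > 1" using assms by (simp add: k_def field_simps)
  have sq: "s powr q = y powr k"
    using s assms by (simp add: y_def k_def powr_realpow[symmetric] powr_powr)
  have "convex_on {0<..} (\<lambda>x::real. x powr k)"
    using k by (intro f''_ge0_imp_convex[where f' = "\<lambda>x. k * x powr (k - 1)" and f'' = "\<lambda>x. k * ((k - 1) * x powr (k - 1 - 1))"])
      (auto intro!: derivative_eq_intros mult_nonneg_nonneg)
  then have "y powr k - 1 powr k \<ge> (k * 1 powr (k - 1)) * (y - 1)"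
    by (rule convex_on_imp_above_tangent) (use y in \<open>auto intro!: derivative_eq_intros simp: interior_open\<close>)
  then have "k * (y - 1) \<le> y powr k - 1" by simp
  then show ?thesis unfolding sq y_def[symmetric] k_def using q assms by (simp add: field_simps)
qed

text \<open>Multiply \<open>ln (1 / y) \<le> 1 / y - 1\<close> by \<open>y\<close>. The equality
  case of this logarithm bound is the source of every strict energy inequality under
  rescaling.\<close>

lemma xlnx_bound:
  fixes y :: real
  assumes "y \<ge> 0"
  shows "y - y * ln y \<le> 1" "y \<noteq> 1 \<Longrightarrow> y - y * ln y < 1"
proof -
  have *: "y - y * ln y \<le> 1 \<and> (y \<noteq> 1 \<longrightarrow> y - y * ln y < 1)"
  proof (cases "y = 0")
    case False
    then have y: "y > 0" using assms by auto
    have "ln (1 / y) \<le> 1 / y - 1" using y by (intro ln_le_minus_one) auto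
    moreover have "ln (1 / y) \<noteq> 1 / y - 1" if "y \<noteq> 1"
      using ln_eq_minus_one[of "1 / y"] y that by auto
    moreover have "ln (1 / y) = - ln y" using y by (simp add: ln_div)
    ultimately show ?thesis using y
      by (auto simp: field_simps order_less_le)
  qed auto
  from * show "y - y * ln y \<le> 1" "y \<noteq> 1 \<Longrightarrow> y - y * ln y < 1" by auto
qed

lemma isCont_abs_powr:
  assumes "0 < e"
  shows "isCont (\<lambda>x::real. \<bar>x\<bar> powr e) x"
proof -
  have "continuous_on UNIV (\<lambda>x::real. \<bar>x\<bar> powr e)"
    using assms by (intro continuous_on_powr' continuous_intros) auto
  then show ?thesis using open_UNIV continuous_on_eq_continuous_at by blast
qed

text \<open>The factor \<open>0 powr e\<close> is 0, so the formula is already the continuous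
  extension to \<open>x = 0\<close> for \<open>e > 0\<close>.\<close>

definition abs_powr_ln :: "real \<Rightarrow> real \<Rightarrow> real" where
  "abs_powr_ln e x = \<bar>x\<bar> powr e * ln \<bar>x\<bar>"

lemma isCont_abs_powr_ln:
  assumes "e > 0"
  shows "isCont (abs_powr_ln e) x"
proof (cases "x = 0")
  case False
  then show ?thesis unfolding abs_powr_ln_def by (intro continuous_intros) auto
next
  case True
  have "((\<lambda>x::real. 2 / e * \<bar>x\<bar> powr (e / 2)) \<longlongrightarrow> 2 / e * \<bar>0\<bar> powr (e / 2)) (at 0)"
    using assms by (intro tendsto_intros) auto
  then have lim: "((\<lambda>x::real. 2 / e * \<bar>x\<bar> powr (e / 2)) \<longlongrightarrow> 0) (at 0)" by simp
  have bd: "\<bar>abs_powr_ln e x\<bar> \<le> 2 / e * \<bar>x\<bar> powr (e / 2)" if x: "x \<noteq> 0" "\<bar>x\<bar> \<le> 1" for x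
  proof -
    \<comment> \<open>Half of the exponent absorbs the logarithm; the other half still tends to
      0.\<close>
    have "ln (1 / \<bar>x\<bar>) \<le> ((1 / \<bar>x\<bar>) powr (e / 2)) / (e / 2)"
      using x assms by (intro ln_powr_bound) auto
    then have "- ln \<bar>x\<bar> \<le> 2 / e * (1 / \<bar>x\<bar>) powr (e / 2)" using x by (simp add: ln_div mult.commute)
    then have "\<bar>x\<bar> powr e * - ln \<bar>x\<bar> \<le> \<bar>x\<bar> powr e * (2 / e * (1 / \<bar>x\<bar>) powr (e / 2))"
      by (intro mult_left_mono) auto
    also have "\<dots> = 2 / e * (\<bar>x\<bar> powr e / \<bar>x\<bar> powr (e / 2))" using x by (simp add: powr_divide)
    also have "\<dots> = 2 / e * \<bar>x\<bar> powr (e / 2)" using x by (simp add: powr_diff[symmetric])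
    finally have 1: "\<bar>x\<bar> powr e * - ln \<bar>x\<bar> \<le> 2 / e * \<bar>x\<bar> powr (e / 2)" .
    have "ln \<bar>x\<bar> \<le> 0" using x by simp
    then have "\<bar>abs_powr_ln e x\<bar> = \<bar>x\<bar> powr e * - ln \<bar>x\<bar>"
      by (simp add: abs_powr_ln_def abs_mult)
    with 1 show ?thesis by simp
  qed
  have "(abs_powr_ln e \<longlongrightarrow> 0) (at 0)"
  proof (rule Lim_null_comparison[OF _ lim])
    show "\<forall>\<^sub>F x in at (0::real). norm (abs_powr_ln e x) \<le> 2 / e * \<bar>x\<bar> powr (e / 2)"
      unfolding eventually_at using bd by (intro exI[of _ 1]) (simp add: dist_norm)
  qed
  then show ?thesis using True assms by (simp add: isCont_def abs_powr_ln_def)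
qed

lemma bounded_on_interval:
  fixes f :: "real \<Rightarrow> real"
  assumes "\<And>x. isCont f x"
  shows "\<exists>C\<ge>0. \<forall>x. \<bar>x\<bar> \<le> M \<longrightarrow> \<bar>f x\<bar> \<le> C"
proof -
  have "compact (f ` {-M..M})"
    using assms by (intro compact_continuous_image continuous_at_imp_continuous_on) auto
  then have "bounded (f ` {-M..M})" by (rule compact_imp_bounded)
  then obtain C where C: "C > 0" "\<forall>y \<in> f ` {-M..M}. norm y \<le> C" by (auto simp: bounded_pos)
  have "\<bar>f x\<bar> \<le> C" if "\<bar>x\<bar> \<le> M" for x
    using that C(2) by (auto simp: abs_le_iff minus_le_iff)
  then show ?thesis using C(1) by (intro exI[of _ C]) simp
qed

section \<open>Limits and compactness for infinite sums and sequences\<close>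

lemma infsum_sum_finite:
  fixes f :: "'i \<Rightarrow> 'a \<Rightarrow> real"
  assumes "finite S" "\<And>i. i \<in> S \<Longrightarrow> f i summable_on UNIV"
  shows "(\<lambda>x. \<Sum>i\<in>S. f i x) summable_on UNIV \<and> infsum (\<lambda>x. \<Sum>i\<in>S. f i x) UNIV = (\<Sum>i\<in>S. infsum (f i) UNIV)"
  using assms
proof (induction S)
  case (insert j S)
  then show ?case using infsum_add[of "f j" UNIV "\<lambda>x. \<Sum>i\<in>S. f i x"] summable_on_add[of "f j" UNIV "\<lambda>x. \<Sum>i\<in>S. f i x"]
    by auto
qed auto

lemma infsum_finite_support:
  fixes f :: "'a \<Rightarrow> real"
  assumes "finite S" "\<And>n. n \<notin> S \<Longrightarrow> f n = 0"
  shows "f summable_on UNIV" "infsum f UNIV = sum f S"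
proof -
  have "f summable_on UNIV \<longleftrightarrow> f summable_on S" using assms by (intro summable_on_cong_neutral) auto
  then show "f summable_on UNIV" using assms by simp
  have "infsum f UNIV = infsum f S" using assms by (intro infsum_cong_neutral) auto
  then show "infsum f UNIV = sum f S" using assms by simp
qed

lemma summable_on_if_abs_le:
  fixes f :: "'a \<Rightarrow> real"
  assumes "g summable_on UNIV" "\<And>x. \<bar>f x\<bar> \<le> g x"
  shows "f summable_on UNIV"
proof (rule Infinite_Sum.abs_summable_summable)
  show "(\<lambda>x. norm (f x)) summable_on UNIV"
    using assms by (intro Infinite_Sum.abs_summable_on_comparison_test'[where g = g]) auto
qed

text \<open>Dominated convergence: the Weierstrass test makes the finite partial sums converge
  uniformly in \<open>k\<close>, so the two limits may be exchanged.\<close>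

lemma tendsto_infsum_dominated:
  fixes f :: "nat \<Rightarrow> 'a \<Rightarrow> real"
  assumes lim: "\<And>x. (\<lambda>k. f k x) \<longlonglongrightarrow> g x"
    and bound: "\<And>k x. \<bar>f k x\<bar> \<le> M x" and M: "M summable_on UNIV"
  shows "g summable_on UNIV" "(\<lambda>k. infsum (f k) UNIV) \<longlonglongrightarrow> infsum g UNIV"
proof -
  have gb: "\<bar>g x\<bar> \<le> M x" for x
    using bound by (intro LIMSEQ_le_const2[OF tendsto_rabs[OF lim]]) auto
  then show g: "g summable_on UNIV"
    using summable_on_if_abs_le[OF M] by blast
  have unif: "uniform_limit UNIV (\<lambda>X k. \<Sum>x\<in>X. f k x) (\<lambda>k. infsum (f k) UNIV) (finite_subsets_at_top UNIV)"
    using bound by (intro Weierstrass_m_test_general[OF _ M]) auto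
  have fin: "\<forall>\<^sub>F X in finite_subsets_at_top UNIV. (\<lambda>k. \<Sum>x\<in>X. f k x) \<longlonglongrightarrow> (\<Sum>x\<in>X. g x)"
    by (intro always_eventually allI tendsto_sum lim)
  have sums: "((\<lambda>X. \<Sum>x\<in>X. g x) \<longlongrightarrow> infsum g UNIV) (finite_subsets_at_top UNIV)"
    using g by (rule infsum_tendsto)
  show "(\<lambda>k. infsum (f k) UNIV) \<longlonglongrightarrow> infsum g UNIV"
    by (rule swap_uniform_limit'[OF fin sums unif]) simp_all
qed

text \<open>Fatou's lemma with a convergent upper bound: each finite partial sum passes to the
  limit, and nonnegative terms with bounded partial sums are summable.\<close>

lemma infsum_le_of_tendsto:
  fixes f :: "nat \<Rightarrow> 'a \<Rightarrow> real"
  assumes lim: "\<And>x. (\<lambda>k. f k x) \<longlonglongrightarrow> g x" and nonneg: "\<And>k x. 0 \<le> f k x"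
    and summ: "\<And>k. f k summable_on UNIV"
    and le: "\<And>k. infsum (f k) UNIV \<le> C k" and C: "C \<longlonglongrightarrow> C'"
  shows "g summable_on UNIV" "infsum g UNIV \<le> C'"
proof -
  have g0: "0 \<le> g x" for x using nonneg by (intro LIMSEQ_le_const[OF lim]) auto
  have fin: "sum g F \<le> C'" if "finite F" for F
  proof (rule LIMSEQ_le[OF tendsto_sum[OF lim] C])
    show "\<exists>N. \<forall>n\<ge>N. (\<Sum>i\<in>F. f n i) \<le> C n"
      using finite_sum_le_infsum[OF summ that] nonneg le by (meson subset_UNIV order_trans)
  qed
  show g: "g summable_on UNIV"
    using g0 fin by (intro nonneg_bdd_above_summable_on bdd_aboveI[of _ C']) auto
  show "infsum g UNIV \<le> C'" using g fin by (intro infsum_le_finite_sums) auto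
qed

text \<open>Tychonoff for the cube of side \<open>[-M, M]\<close>; countability of the index type
  makes the product first countable, so compactness yields convergent subsequences.\<close>

lemma pointwise_bounded_subsequence:
  fixes u :: "nat \<Rightarrow> 'a::countable \<Rightarrow> real"
  assumes "\<And>k n. \<bar>u k n\<bar> \<le> M"
  obtains \<rho> v where "strict_mono (\<rho> :: nat \<Rightarrow> nat)" "\<And>n. (\<lambda>k. u (\<rho> k) n) \<longlonglongrightarrow> v n" "\<And>n. \<bar>v n\<bar> \<le> M"
proof -
  have "compactin (product_topology (\<lambda>_::'a. euclidean) UNIV) (PiE UNIV (\<lambda>_. {-M..M}))"
    by (subst compactin_PiE) auto
  then have "compact (PiE UNIV (\<lambda>_::'a. {-M..M}))"
    by (simp add: euclidean_product_topology)
  then have "seq_compact (PiE UNIV (\<lambda>_::'a. {-M..M}))" by (rule compact_imp_seq_compact)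
  moreover have "\<forall>k. u k \<in> PiE UNIV (\<lambda>_. {-M..M})"
    using assms by (auto simp: PiE_iff abs_le_iff minus_le_iff)
  ultimately obtain v \<rho> where v: "v \<in> PiE UNIV (\<lambda>_::'a. {-M..M})" "strict_mono (\<rho> :: nat \<Rightarrow> nat)" "(u \<circ> \<rho>) \<longlonglongrightarrow> v"
    by (rule seq_compactE)
  have "(\<lambda>k. u (\<rho> k) n) \<longlonglongrightarrow> v n" for n
  proof -
    have "isCont (\<lambda>f::'a \<Rightarrow> real. f n) v"
      using continuous_on_product_coordinates[of n] open_UNIV continuous_on_eq_continuous_at by blast
    from isCont_tendsto_compose[OF this v(3)] show ?thesis by (simp add: o_def)
  qed
  moreover have "\<bar>v n\<bar> \<le> M" for n using v(1) by (auto simp: PiE_iff abs_le_iff minus_le_iff)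
  ultimately show thesis using v(2) that by blast
qed

text \<open>The set \<open>S\<close> does not depend on \<open>k\<close>. If the limit stayed below
  1 at each of its finitely many points, so would all late members of the sequence. The factor
  \<open>e\<close> serves both signs.\<close>

lemma pointwise_limit_exceeds_1:
  fixes u :: "nat \<Rightarrow> 'a \<Rightarrow> real"
  assumes lim: "\<And>n. (\<lambda>k. u k n) \<longlonglongrightarrow> v n" and fin: "finite S" and ex: "\<And>k. \<exists>n\<in>S. 1 < e * u k n"
  shows "\<exists>n. 1 \<le> e * v n"
proof (rule ccontr)
  assume "\<nexists>n. 1 \<le> e * v n"
  then have "\<forall>\<^sub>F k in sequentially. e * u k n < 1" for n
    by (intro order_tendstoD(2)[OF tendsto_mult[OF tendsto_const lim]]) (auto simp: not_le)
  then have "\<forall>\<^sub>F k in sequentially. \<forall>n\<in>S. e * u k n < 1"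
    using fin by (intro eventually_ball_finite) auto
  then obtain k where "\<forall>n\<in>S. e * u k n < 1" by (auto simp: eventually_sequentially)
  then show False using ex[of k] by force
qed

section \<open>Rescaling along sign changes\<close>

text \<open>A labelling is nodal if the label changes only across edges where \<open>u\<close> changes sign (weakly); the
  pieces of \<open>u\<close> may then be scaled independently without losing control of the difference term.\<close>

definition nodal :: "(int \<Rightarrow> 'i) \<Rightarrow> (int \<Rightarrow> real) \<Rightarrow> bool" where
  "nodal \<kappa> u \<longleftrightarrow> (\<forall>n. \<kappa> n = \<kappa> (n + 1) \<or> u n * u (n + 1) \<le> 0)"

definition piece :: "(int \<Rightarrow> 'i) \<Rightarrow> (int \<Rightarrow> real) \<Rightarrow> 'i \<Rightarrow> int \<Rightarrow> real" where
  "piece \<kappa> u i n = (if \<kappa> n = i then u n else 0)"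

definition rescale :: "(int \<Rightarrow> 'i) \<Rightarrow> ('i \<Rightarrow> real) \<Rightarrow> (int \<Rightarrow> real) \<Rightarrow> int \<Rightarrow> real" where
  "rescale \<kappa> s u n = s (\<kappa> n) * u n"

lemma piece_eq_rescale: "piece \<kappa> u i = rescale \<kappa> (\<lambda>j. of_bool (j = i)) u"
  by (auto simp: piece_def rescale_def)

lemma rescale_1: "rescale \<kappa> (\<lambda>_. 1) u = u"
  by (auto simp: rescale_def)

lemma sum_if_label:
  fixes F :: "'i::finite \<Rightarrow> real"
  shows "(\<Sum>i\<in>UNIV. if k = i then F i else 0) = F k"
  by (simp add: sum.delta)

lemma rescale_eq_sum:
  fixes \<kappa> :: "int \<Rightarrow> 'i::finite"
  shows "rescale \<kappa> s u n = (\<Sum>i\<in>UNIV. s i * piece \<kappa> u i n)"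
proof -
  have "(\<Sum>i\<in>UNIV. s i * piece \<kappa> u i n) = (\<Sum>i\<in>UNIV. if \<kappa> n = i then s i * u n else 0)"
    by (intro sum.cong) (auto simp: piece_def)
  then show ?thesis by (simp only: sum_if_label rescale_def)
qed

section \<open>Positive and negative parts as two pieces, and counting sign changes\<close>

definition comb :: "real \<Rightarrow> real \<Rightarrow> (int \<Rightarrow> real) \<Rightarrow> int \<Rightarrow> real" where
  "comb s t u n = s * pos_part u n + t * neg_part u n"

lemma nodal_sign: "nodal (\<lambda>n. 0 < u n) u"
  by (auto simp: nodal_def mult_le_0_iff not_less)

lemma pos_part_eq_piece: "pos_part u = piece (\<lambda>n. 0 < u n) u True"
  by (auto simp: pos_part_def piece_def)

lemma neg_part_eq_piece: "neg_part u = piece (\<lambda>n. 0 < u n) u False"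
  by (auto simp: neg_part_def piece_def)

lemma comb_eq_rescale: "comb s t u = rescale (\<lambda>n. 0 < u n) (\<lambda>i. if i then s else t) u"
  by (auto simp: comb_def rescale_def pos_part_def neg_part_def)

lemma comb_1_1 [simp]: "comb 1 1 u = u"
  by (auto simp: comb_def pos_part_def neg_part_def)

lemma comb_0_0 [simp]: "comb 0 0 u = (\<lambda>_. 0)"
  by (auto simp: comb_def)

lemma
  assumes "0 \<le> s" "0 \<le> t"
  shows pos_part_comb: "pos_part (comb s t u) = (\<lambda>n. s * pos_part u n)"
    and neg_part_comb: "neg_part (comb s t u) = (\<lambda>n. t * neg_part u n)"
proof -
  have "pos_part (comb s t u) n = s * pos_part u n \<and> neg_part (comb s t u) n = t * neg_part u n" for n
  proof (cases "0 \<le> u n")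
    case True
    with assms show ?thesis by (simp add: comb_def pos_part_def neg_part_def)
  next
    case False
    then have "t * u n \<le> 0" using assms by (intro mult_nonneg_nonpos) auto
    with False show ?thesis by (simp add: comb_def pos_part_def neg_part_def)
  qed
  then show "pos_part (comb s t u) = (\<lambda>n. s * pos_part u n)" "neg_part (comb s t u) = (\<lambda>n. t * neg_part u n)"
    by auto
qed

lemma comb_comb: "0 \<le> s \<Longrightarrow> 0 \<le> t \<Longrightarrow> comb s' t' (comb s t u) = comb (s' * s) (t' * t) u"
  by (intro ext) (simp add: comb_def[of s' t'] pos_part_comb neg_part_comb comb_def[of "s' * s"])

lemma pos_part_nonzero_iff: "pos_part u \<noteq> (\<lambda>_. 0) \<longleftrightarrow> (\<exists>n. 0 < u n)"
  by (auto simp: pos_part_def fun_eq_iff max_def not_le)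

lemma neg_part_nonzero_iff: "neg_part u \<noteq> (\<lambda>_. 0) \<longleftrightarrow> (\<exists>n. u n < 0)"
proof -
  have "min x 0 \<noteq> 0 \<longleftrightarrow> x < 0" for x :: real by auto
  then show ?thesis by (simp add: neg_part_def fun_eq_iff)
qed

text \<open>With the sign \<open>e\<close> normalizing the first value to be positive, cut at the
  last positive index \<open>k\<close> in \<open>{i..j}\<close>. A wrong sign on either side of
  \<open>k\<close> completes a forbidden triple: \<open>n, i, j\<close> or \<open>i, n, k\<close> to
  the left, \<open>i, j, n\<close> to the right.\<close>

lemma no_triple_imp_changes_sign_once:
  assumes pn: "0 < u i" "u j < 0"
    and no: "\<And>e n1 n2 n3. e = 1 \<or> e = -1 \<Longrightarrow> n1 < n2 \<Longrightarrow> n2 < n3 \<Longrightarrow> 0 < e * u n1 \<Longrightarrow> e * u n2 < 0 \<Longrightarrow> 0 < e * u n3 \<Longrightarrow> False"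
  shows "changes_sign_once u"
proof -
  have main: "\<exists>k. (\<forall>n\<le>k. 0 \<le> e * u n) \<and> (\<forall>n>k. e * u n \<le> 0)"
    if e: "e = 1 \<or> e = -1" and ij: "0 < e * u i" "e * u j < 0" "i < j" for e i j
  proof -
    have e': "- e = 1 \<or> - e = -1" using e by auto
    define S where "S = {n \<in> {i..j}. 0 < e * u n}"
    have "finite S" by (rule finite_subset[of _ "{i..j}"]) (auto simp: S_def)
    have "i \<in> S" using ij by (auto simp: S_def)
    define k where "k = Max S"
    have k: "k \<in> S" "\<And>n. n \<in> S \<Longrightarrow> n \<le> k"
      using \<open>finite S\<close> \<open>i \<in> S\<close> by (auto simp: k_def intro: Max_in)
    have kj: "0 < e * u k" "k < j" using k(1) ij by (auto simp: S_def order_le_less)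
    have "e * u n \<le> 0" if n: "k < n" for n
    proof (rule ccontr)
      assume a: "\<not> e * u n \<le> 0"
      then have "n \<notin> {i..j}" using k(2)[of n] n by (auto simp: S_def)
      then have "j < n" using n k(2)[OF \<open>i \<in> S\<close>] by auto
      then show False using no[OF e \<open>i < j\<close>, of n] ij a by auto
    qed
    moreover have "0 \<le> e * u n" if n: "n \<le> k" for n
    proof (rule ccontr)
      assume a: "\<not> 0 \<le> e * u n"
      then have "n \<noteq> k" "n \<noteq> i" using kj ij by auto
      then consider "n < i" | "i < n" "n < k" using n by linarith
      then show False
      proof cases
        case 1
        then show False using no[OF e' 1 \<open>i < j\<close>] ij a by auto
      next
        case 2
        then show False using no[OF e 2] ij a kj by auto
      qed
    qed
    ultimately show ?thesis by blast
  qed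
  have "i \<noteq> j" using pn by auto
  then consider "i < j" | "j < i" by linarith
  then show ?thesis
  proof cases
    case 1
    then show ?thesis using main[of 1 i j] pn by (auto simp: changes_sign_once_def)
  next
    case 2
    then show ?thesis using main[of "-1" j i] pn by (auto simp: changes_sign_once_def)
  qed
qed

text \<open>Plain cut-offs of \<open>v \<in> E\<close> need not converge to \<open>v\<close>, because \<open>a\<close> is unbounded. Soft thresholding
  increases neither \<open>\<bar>v n\<bar>\<close> nor \<open>\<bar>fdiff v n\<bar>\<close>, and it produces finitely supported sequences.\<close>

definition soft :: "real \<Rightarrow> real \<Rightarrow> real" where
  "soft \<epsilon> x = x - max (- \<epsilon>) (min \<epsilon> x)"

lemma soft_lipschitz: "0 \<le> \<epsilon> \<Longrightarrow> \<bar>soft \<epsilon> x - soft \<epsilon> y\<bar> \<le> \<bar>x - y\<bar>"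
  by (auto simp: soft_def max_def min_def)

lemma soft_abs_le: "0 \<le> \<epsilon> \<Longrightarrow> \<bar>soft \<epsilon> x\<bar> \<le> \<bar>x\<bar>"
  by (auto simp: soft_def max_def min_def)

lemma soft_eq_0: "\<bar>x\<bar> \<le> \<epsilon> \<Longrightarrow> soft \<epsilon> x = 0"
  by (auto simp: soft_def max_def min_def)

lemma soft_close: "0 \<le> \<epsilon> \<Longrightarrow> \<bar>soft \<epsilon> x - x\<bar> \<le> \<epsilon>"
  by (auto simp: soft_def max_def min_def)

section \<open>The energy functional\<close>

locale log_laplacian =
  fixes P :: nat and q r :: real and a b c :: "int \<Rightarrow> real" and b0 :: real
  assumes P_even: "even P" and P_ge: "2 \<le> P" and P_less_q: "real P < q" and r_ge: "1 \<le> r"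
    and a_pos: "0 < a n" and b0_pos: "0 < b0" and b_ge: "b0 \<le> b n" and c_pos: "0 < c n"
    and b_lim: "filterlim b at_top cofinite"
    and c_summable: "c summable_on UNIV"
begin

text \<open>With \<open>p = P\<close> even, all terms \<open>\<bar>x\<bar> powr p\<close> and \<open>\<bar>x\<bar> powr (p - 2) * x\<close> are ordinary powers.\<close>

definition kin :: "(int \<Rightarrow> real) \<Rightarrow> int \<Rightarrow> real" where
  "kin u n = a n * fdiff u n ^ P + b n * u n ^ P"

definition dkin :: "(int \<Rightarrow> real) \<Rightarrow> (int \<Rightarrow> real) \<Rightarrow> int \<Rightarrow> real" where
  "dkin u v n = a n * fdiff u n ^ (P - 1) * fdiff v n + b n * u n ^ (P - 1) * v n"

definition E :: "(int \<Rightarrow> real) set" where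
  "E = {u. kin u summable_on UNIV}"

definition K :: "(int \<Rightarrow> real) \<Rightarrow> real" where
  "K u = (\<Sum>\<^sub>\<infinity>n. kin u n)"

definition dK :: "(int \<Rightarrow> real) \<Rightarrow> (int \<Rightarrow> real) \<Rightarrow> real" where
  "dK u v = (\<Sum>\<^sub>\<infinity>n. dkin u v n)"

definition eta :: "real \<Rightarrow> real" where
  "eta x = \<bar>x\<bar> powr q * ln (\<bar>x\<bar> powr r)"

definition psi :: "real \<Rightarrow> real" where
  "psi x = \<bar>x\<bar> powr (q - 2) * x * ln (\<bar>x\<bar> powr r)"

text \<open>The logarithmic energy density, a primitive of \<open>- psi\<close>: the term
  \<open>r / q\<^sup>2 * \<bar>x\<bar> powr q\<close> cancels what the product rule produces from
  differentiating the logarithm.\<close>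

definition Hlog :: "real \<Rightarrow> real" where
  "Hlog x = r / q\<^sup>2 * \<bar>x\<bar> powr q - eta x / q"

definition A :: "(int \<Rightarrow> real) \<Rightarrow> real" where
  "A u = (\<Sum>\<^sub>\<infinity>n. c n * \<bar>u n\<bar> powr q)"

definition B :: "(int \<Rightarrow> real) \<Rightarrow> real" where
  "B u = (\<Sum>\<^sub>\<infinity>n. c n * eta (u n))"

definition dB :: "(int \<Rightarrow> real) \<Rightarrow> (int \<Rightarrow> real) \<Rightarrow> real" where
  "dB u v = (\<Sum>\<^sub>\<infinity>n. c n * psi (u n) * v n)"

definition J :: "(int \<Rightarrow> real) \<Rightarrow> real" where
  "J u = K u / real P + r / q\<^sup>2 * A u - B u / q"

definition dJ :: "(int \<Rightarrow> real) \<Rightarrow> (int \<Rightarrow> real) \<Rightarrow> real" where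
  "dJ u v = dK u v - dB u v"

text \<open>The value of \<open>r / q\<^sup>2 * A - B / q\<close> for a piece scaled by
  \<open>s\<close>, when the unscaled piece has \<open>A = \<alpha>\<close> and
  \<open>B = \<beta>\<close>. The term with \<open>ln s\<close> comes from splitting the logarithm
  of a product.\<close>

definition log_part :: "real \<Rightarrow> real \<Rightarrow> real \<Rightarrow> real" where
  "log_part \<alpha> \<beta> s = r / q\<^sup>2 * (s powr q * \<alpha>) - (s powr q * \<beta> + r * (s powr q * ln s) * \<alpha>) / q"

lemma P_ge1: "P \<ge> 1" using P_ge by simp

lemma q_gt2: "q > 2" using P_ge P_less_q by linarith

lemma b_pos: "0 < b n" using b0_pos b_ge[of n] by linarith

lemma pow_nonneg: "0 \<le> (x::real) ^ P" using P_even by (rule zero_le_even_power)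

lemma pow_P: "(x::real) ^ (P - 1) * x = x ^ P"
  using P_ge1 by (metis One_nat_def Suc_pred less_eq_Suc_le mult.commute power_Suc)

lemma abs_powr_P: "\<bar>x\<bar> powr real P = x ^ P"
  using P_even P_ge by (cases "x = 0") (simp_all add: powr_realpow power_even_abs)

lemma abs_powr_P2: "\<bar>x\<bar> powr (real P - 2) * x = x ^ (P - 1)"
proof (cases "x = 0")
  case False
  have "even (P - 2)" using P_even by simp
  moreover have "real P - 2 = real (P - 2)" using P_ge by simp
  ultimately have "\<bar>x\<bar> powr (real P - 2) = x ^ (P - 2)"
    using False by (simp only: powr_realpow[of "\<bar>x\<bar>"] power_even_abs zero_less_abs_iff simp_thms)
  moreover have "P - 1 = Suc (P - 2)" using P_ge by simp
  ultimately show ?thesis by simp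
qed (use P_ge in auto)

lemma eta_0 [simp]: "eta 0 = 0" by (simp add: eta_def)
lemma psi_0 [simp]: "psi 0 = 0" by (simp add: psi_def)

text \<open>Splitting off two factors \<open>x\<close> leaves the exponent \<open>q - 2 > 0\<close>,
  so continuity of both \<open>eta\<close> and \<open>psi\<close> reduces to that of
  \<open>abs_powr_ln (q - 2)\<close>.\<close>

lemma eta_eq: "eta x = r * (x * (x * abs_powr_ln (q - 2) x))"
proof (cases "x = 0")
  case False
  have "\<bar>x\<bar> powr q = \<bar>x\<bar> powr (q - 2) * \<bar>x\<bar> powr 2"
    unfolding powr_add[symmetric] by simp
  also have "\<bar>x\<bar> powr 2 = x * x" by (simp add: power2_eq_square flip: power2_abs)
  finally show ?thesis using False by (simp add: eta_def abs_powr_ln_def ln_powr)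
qed simp

lemma psi_eq: "psi x = r * (x * abs_powr_ln (q - 2) x)"
  by (cases "x = 0") (simp_all add: psi_def abs_powr_ln_def ln_powr)

lemma psi_mult_self: "psi x * x = eta x"
  by (simp add: psi_eq eta_eq)

lemma isCont_eta: "isCont eta x"
  unfolding eta_eq[abs_def] using q_gt2 by (intro continuous_intros isCont_abs_powr_ln) auto

lemma isCont_psi: "isCont psi x"
  unfolding psi_eq[abs_def] using q_gt2 by (intro continuous_intros isCont_abs_powr_ln) auto

lemma eta_mult: "0 \<le> s \<Longrightarrow> eta (s * x) = s powr q * eta x + r * (s powr q * ln s) * \<bar>x\<bar> powr q"
  by (cases "s = 0"; cases "x = 0")
     (simp_all add: eta_def abs_mult powr_mult ln_powr ln_mult algebra_simps)

lemma fdiff_lin: "fdiff (\<lambda>n. \<Sum>i\<in>S. s i * f i n) n = (\<Sum>i\<in>S. s i * fdiff (f i) n)"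
  by (simp add: fdiff_def sum_subtractf right_diff_distrib)

lemma dkin_sum: "dkin u (\<lambda>n. \<Sum>i\<in>S. s i * f i n) n = (\<Sum>i\<in>S. s i * dkin u (f i) n)"
  by (simp add: dkin_def fdiff_lin sum_distrib_left sum.distrib algebra_simps)

lemma dkin_self: "dkin u u n = kin u n"
  using pow_P by (simp add: dkin_def kin_def mult.assoc)

lemma dK_self: "dK u u = K u"
proof -
  have "dkin u u = kin u" by (intro ext dkin_self)
  then show ?thesis by (simp add: dK_def K_def)
qed

lemma kin_nonneg: "0 \<le> kin u n"
  using a_pos[of n] b_pos[of n] pow_nonneg by (simp add: kin_def)

lemma b_pow_le_kin: "b n * u n ^ P \<le> kin u n"
  using a_pos[of n] pow_nonneg by (simp add: kin_def)

lemma kin_le_K: "u \<in> E \<Longrightarrow> kin u n \<le> K u"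
  using finite_sum_le_infsum[of "kin u" UNIV "{n}"] kin_nonneg by (auto simp: E_def K_def)

lemma K_nonneg: "0 \<le> K u" unfolding K_def by (intro infsum_nonneg kin_nonneg)

lemma K_pos: assumes "u \<in> E" "u \<noteq> (\<lambda>_. 0)" shows "0 < K u"
proof -
  obtain n where "u n \<noteq> 0" using assms by auto
  then have "0 < u n ^ P" using pow_nonneg[of "u n"] P_ge by (auto simp: order_less_le)
  then have "0 < b n * u n ^ P" using b_pos by simp
  then show ?thesis using b_pow_le_kin[of n u] kin_le_K[OF assms(1), of n] by linarith
qed

text \<open>Either \<open>\<bar>u n\<bar> \<le> 1\<close>, or
  \<open>\<bar>u n\<bar> \<le> u n ^ P\<close>, which the energy controls through \<open>b0\<close>.
  The summand 1 avoids a \<open>P\<close>-th root.\<close>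

lemma abs_le_of_K:
  assumes "u \<in> E" shows "\<bar>u n\<bar> \<le> 1 + K u / b0"
proof (cases "\<bar>u n\<bar> \<le> 1")
  case True
  then show ?thesis using K_nonneg[of u] b0_pos by (smt (verit) divide_nonneg_pos)
next
  case False
  then have "\<bar>u n\<bar> \<le> \<bar>u n\<bar> ^ P" using P_ge1 by (intro self_le_power) auto
  also have "\<dots> = u n ^ P" using P_even by (rule power_even_abs)
  finally have "b0 * \<bar>u n\<bar> \<le> b n * u n ^ P"
    using b_ge[of n] b0_pos by (intro mult_mono) auto
  then have "b0 * \<bar>u n\<bar> \<le> K u" using b_pow_le_kin[of n u] kin_le_K[OF assms, of n] by linarith
  then have "\<bar>u n\<bar> \<le> K u / b0" using b0_pos by (simp add: field_simps)
  then show ?thesis by simp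
qed

text \<open>The values \<open>u n\<close> stay in a compact interval on which \<open>f\<close> is
  bounded, so a multiple of \<open>c\<close> is a majorant. Applied to \<open>eta\<close>, this is
  why the domain of the functional is all of \<open>E\<close>.\<close>

lemma c_mult_summable:
  fixes f :: "real \<Rightarrow> real"
  assumes "\<And>x. isCont f x" "\<And>n. \<bar>u n\<bar> \<le> M"
  shows "(\<lambda>n. c n * f (u n)) summable_on UNIV"
proof -
  obtain C where "0 \<le> C" and C: "\<And>x. \<bar>x\<bar> \<le> M \<Longrightarrow> \<bar>f x\<bar> \<le> C"
    using bounded_on_interval[of f M] assms(1) by auto
  show ?thesis
  proof (rule summable_on_if_abs_le)
    show "(\<lambda>n. c n * C) summable_on UNIV" by (intro summable_on_cmult_left c_summable)
    show "\<bar>c n * f (u n)\<bar> \<le> c n * C" for n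
      using C[OF assms(2)] c_pos[of n] by (simp add: abs_mult)
  qed
qed

lemma E_eta_summable: "u \<in> E \<Longrightarrow> (\<lambda>n. c n * eta (u n)) summable_on UNIV"
  by (rule c_mult_summable[OF isCont_eta abs_le_of_K])

lemma E_powr_summable: "u \<in> E \<Longrightarrow> (\<lambda>n. c n * \<bar>u n\<bar> powr q) summable_on UNIV"
  using q_gt2 by (intro c_mult_summable[OF isCont_abs_powr abs_le_of_K]) auto

lemma A_nonneg: "0 \<le> A u"
  unfolding A_def using c_pos by (intro infsum_nonneg mult_nonneg_nonneg) (auto simp: less_imp_le)

lemma A_pos: assumes "u \<in> E" "u \<noteq> (\<lambda>_. 0)" shows "0 < A u"
proof -
  obtain n where "u n \<noteq> 0" using assms by auto
  then have "0 < c n * \<bar>u n\<bar> powr q" using c_pos[of n] by simp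
  also have "\<dots> \<le> A u"
    using finite_sum_le_infsum[OF E_powr_summable[OF assms(1)], of "{n}"] c_pos
    by (simp add: A_def less_imp_le)
  finally show ?thesis .
qed

section \<open>The energy of a sequence whose nodal pieces are scaled independently\<close>

lemma kin_rescale_le:
  assumes "nodal \<kappa> u"
  shows "kin (rescale \<kappa> s u) n \<le> dkin u (rescale \<kappa> (\<lambda>i. s i ^ P) u) n"
proof -
  \<comment> \<open>Nodality is exactly the case distinction of the edge estimate. At a site there
    is a single factor, so the \<open>b\<close> term is an equality.\<close>
  have "s (\<kappa> (n + 1)) = s (\<kappa> n) \<or> u (n + 1) * u n \<le> 0"
    using assms unfolding nodal_def by (metis mult.commute)
  from even_power_weighted[OF P_even P_ge1 this]
  have "a n * fdiff (rescale \<kappa> s u) n ^ P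
      \<le> a n * (fdiff u n ^ (P - 1) * fdiff (rescale \<kappa> (\<lambda>i. s i ^ P) u) n)"
    using a_pos[of n] by (intro mult_left_mono) (auto simp: fdiff_def rescale_def)
  moreover have "b n * rescale \<kappa> s u n ^ P = b n * u n ^ (P - 1) * rescale \<kappa> (\<lambda>i. s i ^ P) u n"
    using pow_P[of "u n"] by (simp add: rescale_def power_mult_distrib)
  ultimately show ?thesis unfolding kin_def dkin_def mult.assoc by linarith
qed

lemma dkin_rescale:
  fixes \<kappa> :: "int \<Rightarrow> 'i::finite"
  shows "dkin u (rescale \<kappa> s w) n = (\<Sum>i\<in>UNIV. s i * dkin u (piece \<kappa> w i) n)"
  unfolding rescale_eq_sum[abs_def] by (rule dkin_sum)

text \<open>A 0-1 factor equals its own \<open>P\<close>-th power, so the rescaling bound has the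
  same piece on both sides. Hence the energy of a piece is controlled by the quantity that the
  constraints prescribe.\<close>

lemma kin_piece_le:
  assumes "nodal \<kappa> u"
  shows "kin (piece \<kappa> u i) n \<le> dkin u (piece \<kappa> u i) n"
proof -
  have e: "(\<lambda>j. of_bool (j = i) ^ P) = (\<lambda>j. of_bool (j = i) :: real)"
    using P_ge by (auto simp: power_0_left)
  show ?thesis
    using kin_rescale_le[OF assms, of "\<lambda>j. of_bool (j = i)" n]
    unfolding piece_eq_rescale e by simp
qed

lemma dkin_piece_nonneg: "nodal \<kappa> u \<Longrightarrow> 0 \<le> dkin u (piece \<kappa> u i) n"
  using kin_piece_le[of \<kappa> u i n] kin_nonneg[of "piece \<kappa> u i" n] by linarith

text \<open>The mixed terms of the pieces are nonnegative and add up to \<open>kin u n\<close>, so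
  each is at most the total. This gives their summability.\<close>

lemma dkin_piece_le:
  fixes \<kappa> :: "int \<Rightarrow> 'i::finite"
  assumes "nodal \<kappa> u"
  shows "dkin u (piece \<kappa> u i) n \<le> kin u n"
proof -
  have "dkin u (piece \<kappa> u i) n \<le> (\<Sum>i\<in>UNIV. dkin u (piece \<kappa> u i) n)"
    by (rule member_le_sum) (auto intro: dkin_piece_nonneg[OF assms])
  also have "\<dots> = kin u n"
    using dkin_rescale[of u \<kappa> "\<lambda>_. 1" u n] by (simp add: rescale_1 dkin_self)
  finally show ?thesis .
qed

context
  fixes \<kappa> :: "int \<Rightarrow> 'i::finite" and u
  assumes uE: "u \<in> E" and nod: "nodal \<kappa> u"
begin

lemma dkin_piece_summable: "dkin u (piece \<kappa> u i) summable_on UNIV"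
  by (rule summable_on_comparison_test[OF uE[unfolded E_def mem_Collect_eq] dkin_piece_le[OF nod] dkin_piece_nonneg[OF nod]])

lemma dkin_rescale_summable: "dkin u (rescale \<kappa> s u) summable_on UNIV"
  and dK_rescale: "dK u (rescale \<kappa> s u) = (\<Sum>i\<in>UNIV. s i * dK u (piece \<kappa> u i))"
proof -
  have "(\<lambda>n. s i * dkin u (piece \<kappa> u i) n) summable_on UNIV" for i
    by (intro summable_on_cmult_right dkin_piece_summable)
  from infsum_sum_finite[of UNIV "\<lambda>i n. s i * dkin u (piece \<kappa> u i) n", OF _ this]
  show "dkin u (rescale \<kappa> s u) summable_on UNIV" "dK u (rescale \<kappa> s u) = (\<Sum>i\<in>UNIV. s i * dK u (piece \<kappa> u i))"
    by (simp_all add: dkin_rescale[abs_def] dK_def infsum_cmult_right')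
qed

lemma rescale_in_E: "rescale \<kappa> s u \<in> E"
  unfolding E_def mem_Collect_eq
  by (rule summable_on_comparison_test[OF dkin_rescale_summable kin_rescale_le[OF nod] kin_nonneg])

lemma piece_in_E: "piece \<kappa> u i \<in> E"
  unfolding piece_eq_rescale by (rule rescale_in_E)

lemma K_rescale_le: "K (rescale \<kappa> s u) \<le> (\<Sum>i\<in>UNIV. s i ^ P * dK u (piece \<kappa> u i))"
proof -
  have "K (rescale \<kappa> s u) \<le> dK u (rescale \<kappa> (\<lambda>i. s i ^ P) u)"
    unfolding K_def dK_def using rescale_in_E[of s] dkin_rescale_summable
    by (intro infsum_mono kin_rescale_le nod) (auto simp: E_def)
  then show ?thesis by (simp only: dK_rescale)
qed

lemma K_piece_le: "K (piece \<kappa> u i) \<le> dK u (piece \<kappa> u i)"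
  unfolding K_def dK_def using piece_in_E dkin_piece_summable
  by (intro infsum_mono kin_piece_le nod) (auto simp: E_def)

text \<open>Exact, unlike the kinetic part: at each site only one piece can be nonzero, and no
  neighbours enter.\<close>

lemma A_rescale:
  assumes "\<And>i. 0 \<le> s i"
  shows "A (rescale \<kappa> s u) = (\<Sum>i\<in>UNIV. s i powr q * A (piece \<kappa> u i))"
proof -
  have e: "c n * \<bar>rescale \<kappa> s u n\<bar> powr q = (\<Sum>i\<in>UNIV. s i powr q * (c n * \<bar>piece \<kappa> u i n\<bar> powr q))" for n
  proof -
    have "(\<Sum>i\<in>UNIV. s i powr q * (c n * \<bar>piece \<kappa> u i n\<bar> powr q))
        = (\<Sum>i\<in>UNIV. if \<kappa> n = i then s i powr q * (c n * \<bar>u n\<bar> powr q) else 0)"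
      by (intro sum.cong) (auto simp: piece_def)
    also have "\<dots> = c n * \<bar>rescale \<kappa> s u n\<bar> powr q"
      unfolding sum_if_label using assms by (simp add: rescale_def abs_mult powr_mult)
    finally show ?thesis ..
  qed
  have "(\<lambda>n. s i powr q * (c n * \<bar>piece \<kappa> u i n\<bar> powr q)) summable_on UNIV" for i
    by (intro summable_on_cmult_right E_powr_summable piece_in_E)
  from infsum_sum_finite[of UNIV "\<lambda>i n. s i powr q * (c n * \<bar>piece \<kappa> u i n\<bar> powr q)", OF _ this]
  show ?thesis unfolding A_def e by (simp add: infsum_cmult_right')
qed

lemma B_rescale:
  assumes "\<And>i. 0 \<le> s i"
  shows "B (rescale \<kappa> s u) = (\<Sum>i\<in>UNIV. s i powr q * B (piece \<kappa> u i) + r * (s i powr q * ln (s i)) * A (piece \<kappa> u i))"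
proof -
  let ?f = "\<lambda>i n. s i powr q * (c n * eta (piece \<kappa> u i n)) + r * (s i powr q * ln (s i)) * (c n * \<bar>piece \<kappa> u i n\<bar> powr q)"
  have e: "c n * eta (rescale \<kappa> s u n) = (\<Sum>i\<in>UNIV. ?f i n)" for n
  proof -
    have "(\<Sum>i\<in>UNIV. ?f i n)
        = (\<Sum>i\<in>UNIV. if \<kappa> n = i then s i powr q * (c n * eta (u n)) + r * (s i powr q * ln (s i)) * (c n * \<bar>u n\<bar> powr q) else 0)"
      by (intro sum.cong) (auto simp: piece_def)
    also have "\<dots> = c n * eta (rescale \<kappa> s u n)"
      unfolding sum_if_label rescale_def eta_mult[OF assms] by (simp add: algebra_simps)
    finally show ?thesis ..
  qed
  have s: "(\<lambda>n. s i powr q * (c n * eta (piece \<kappa> u i n))) summable_on UNIV"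
    "(\<lambda>n. r * (s i powr q * ln (s i)) * (c n * \<bar>piece \<kappa> u i n\<bar> powr q)) summable_on UNIV" for i
    by (intro summable_on_cmult_right E_powr_summable E_eta_summable piece_in_E)+
  from infsum_sum_finite[of UNIV ?f, OF _ summable_on_add[OF s]]
  show ?thesis unfolding B_def A_def e by (simp add: infsum_cmult_right' infsum_add[OF s])
qed

lemma J_rescale:
  assumes "\<And>i. 0 \<le> s i"
  shows "J (rescale \<kappa> s u) = K (rescale \<kappa> s u) / real P
    + (\<Sum>i\<in>UNIV. log_part (A (piece \<kappa> u i)) (B (piece \<kappa> u i)) (s i))"
proof -
  let ?A = "\<lambda>i. s i powr q * A (piece \<kappa> u i)"
  let ?B = "\<lambda>i. s i powr q * B (piece \<kappa> u i) + r * (s i powr q * ln (s i)) * A (piece \<kappa> u i)"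
  have "(\<Sum>i\<in>UNIV. r / q\<^sup>2 * ?A i - ?B i / q) = r / q\<^sup>2 * sum ?A UNIV - sum ?B UNIV / q"
    unfolding sum_subtractf sum_distrib_left sum_divide_distrib ..
  moreover have "J (rescale \<kappa> s u) = K (rescale \<kappa> s u) / real P + r / q\<^sup>2 * sum ?A UNIV - sum ?B UNIV / q"
    by (simp only: J_def A_rescale[OF assms] B_rescale[OF assms])
  ultimately show ?thesis unfolding log_part_def by linarith
qed

lemma dB_piece: "dB u (piece \<kappa> u i) = B (piece \<kappa> u i)"
proof -
  have "psi (u n) * piece \<kappa> u i n = eta (piece \<kappa> u i n)" for n
    by (simp add: piece_def psi_mult_self)
  then show ?thesis unfolding dB_def B_def by (simp add: mult.assoc)
qed

end

text \<open>With \<open>y = s powr q\<close>, the \<open>\<alpha>\<close> part is a multiple of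
  \<open>y - y * ln y\<close>, maximal at \<open>y = 1\<close>; the \<open>\<beta>\<close> part is
  the comparison of exponents \<open>P < q\<close>. The subtracted term is what the kinetic bound
  gains when a critical piece is scaled by \<open>s\<close>.\<close>

lemma log_part_le:
  assumes "0 \<le> \<alpha>" "0 \<le> \<beta>" "0 \<le> s"
  shows "log_part \<alpha> \<beta> s \<le> log_part \<alpha> \<beta> 1 - (s ^ P - 1) / real P * \<beta>"
    and "0 < \<alpha> \<Longrightarrow> s \<noteq> 1 \<Longrightarrow> log_part \<alpha> \<beta> s < log_part \<alpha> \<beta> 1 - (s ^ P - 1) / real P * \<beta>"
proof -
  define y where "y = s powr q"
  have q: "q > 0" using q_gt2 by simp
  have ylny: "y * ln y = q * (y * ln s)"
    using assms(3) by (cases "s = 0") (auto simp: y_def ln_powr)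
  have lp: "log_part \<alpha> \<beta> s = r / q\<^sup>2 * \<alpha> * (y - y * ln y) - y / q * \<beta>"
    unfolding log_part_def y_def[symmetric] ylny using q by (simp add: field_simps power2_eq_square)
  have lp1: "log_part \<alpha> \<beta> 1 = r / q\<^sup>2 * \<alpha> - 1 / q * \<beta>" by (simp add: log_part_def)
  have "(s ^ P - 1) / real P \<le> (y - 1) / q"
    unfolding y_def by (rule power_diff_quotient_le[OF assms(3) P_ge1 P_less_q])
  from mult_right_mono[OF this assms(2)]
  have b: "(s ^ P - 1) / real P * \<beta> \<le> y / q * \<beta> - 1 / q * \<beta>" by (simp add: diff_divide_distrib left_diff_distrib)
  have y0: "y \<ge> 0" by (simp add: y_def)
  have k: "0 \<le> r / q\<^sup>2 * \<alpha>" using r_ge assms by simp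
  from mult_left_mono[OF xlnx_bound(1)[OF y0] k]
  show "log_part \<alpha> \<beta> s \<le> log_part \<alpha> \<beta> 1 - (s ^ P - 1) / real P * \<beta>"
    using b unfolding lp lp1 by simp
  assume "0 < \<alpha>" "s \<noteq> 1"
  then have k: "0 < r / q\<^sup>2 * \<alpha>" using r_ge q by simp
  have "y \<noteq> 1"
  proof
    assume "y = 1"
    then have "s powr q = 1 powr q" by (simp add: y_def)
    then show False using \<open>s \<noteq> 1\<close> assms(3) q powr_inj[of q s 1]
      by (metis abs_of_nonneg powr_less_mono2 linorder_neqE_linordered_idom order_less_irrefl zero_le_one)
  qed
  from mult_strict_left_mono[OF xlnx_bound(2)[OF y0 this] k]
  show "log_part \<alpha> \<beta> s < log_part \<alpha> \<beta> 1 - (s ^ P - 1) / real P * \<beta>"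
    using b unfolding lp lp1 by simp
qed

text \<open>Criticality identifies \<open>dK u (piece \<kappa> u i)\<close> with
  \<open>\<beta> i\<close>, so the kinetic gain \<open>(s i ^ P - 1) / P * \<beta> i\<close> cancels
  against the logarithmic loss piece by piece. Nonnegativity of \<open>\<beta> i\<close> comes from
  the energy of the piece; one strict index makes the sum strict.\<close>

lemma
  fixes \<kappa> :: "int \<Rightarrow> 'i::finite"
  assumes u: "u \<in> E" "nodal \<kappa> u" and crit: "\<And>i. dJ u (piece \<kappa> u i) = 0" and s: "\<And>i. 0 \<le> s i"
  shows J_rescale_le: "J (rescale \<kappa> s u) \<le> J u"
    and J_rescale_less: "s i \<noteq> 1 \<Longrightarrow> piece \<kappa> u i \<noteq> (\<lambda>_. 0) \<Longrightarrow> J (rescale \<kappa> s u) < J u"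
proof -
  define \<alpha> \<beta> where "\<alpha> i = A (piece \<kappa> u i)" and "\<beta> i = B (piece \<kappa> u i)" for i
  have B: "dK u (piece \<kappa> u i) = \<beta> i" for i
    using crit[of i] dB_piece[OF u] by (simp add: dJ_def \<beta>_def)
  have \<beta>: "0 \<le> \<beta> i" for i
    using K_piece_le[OF u, of i] K_nonneg[of "piece \<kappa> u i"] by (simp add: B)
  have \<alpha>: "0 \<le> \<alpha> i" for i by (simp add: \<alpha>_def A_nonneg)
  have Ku: "K u = (\<Sum>i\<in>UNIV. \<beta> i)"
    using dK_rescale[OF u, of "\<lambda>_. 1"] by (simp add: rescale_1 B dK_self)
  have Ju: "J u = (\<Sum>i\<in>UNIV. \<beta> i / real P + log_part (\<alpha> i) (\<beta> i) 1)"
    using J_rescale[OF u, of "\<lambda>_. 1"]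
    by (simp add: rescale_1 Ku \<alpha>_def \<beta>_def sum.distrib sum_divide_distrib)
  have Js: "J (rescale \<kappa> s u) \<le> (\<Sum>i\<in>UNIV. s i ^ P * \<beta> i / real P + log_part (\<alpha> i) (\<beta> i) (s i))"
    using J_rescale[OF u s] divide_right_mono[OF K_rescale_le[OF u, of s], of "real P"]
    by (simp add: B \<alpha>_def \<beta>_def sum.distrib sum_divide_distrib)
  have le: "s i ^ P * \<beta> i / real P + log_part (\<alpha> i) (\<beta> i) (s i) \<le> \<beta> i / real P + log_part (\<alpha> i) (\<beta> i) 1" for i
    using log_part_le(1)[OF \<alpha> \<beta> s, of i i i] by (simp add: diff_divide_distrib left_diff_distrib)
  then show "J (rescale \<kappa> s u) \<le> J u"
    unfolding Ju using Js by (meson order_trans sum_mono)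
  assume i: "s i \<noteq> 1" "piece \<kappa> u i \<noteq> (\<lambda>_. 0)"
  then have "0 < \<alpha> i" unfolding \<alpha>_def using piece_in_E[OF u] by (intro A_pos) auto
  then have "s i ^ P * \<beta> i / real P + log_part (\<alpha> i) (\<beta> i) (s i) < \<beta> i / real P + log_part (\<alpha> i) (\<beta> i) 1"
    using log_part_le(2)[OF \<alpha> \<beta> s _ i(1), of i i] by (simp add: diff_divide_distrib left_diff_distrib)
  then have "(\<Sum>i\<in>UNIV. s i ^ P * \<beta> i / real P + log_part (\<alpha> i) (\<beta> i) (s i))
      < (\<Sum>i\<in>UNIV. \<beta> i / real P + log_part (\<alpha> i) (\<beta> i) 1)"
    using le by (intro sum_strict_mono_ex1) auto
  then show "J (rescale \<kappa> s u) < J u" unfolding Ju using Js by linarith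
qed

section \<open>Agreement with the stated definitions\<close>

lemma norm_term_eq: "norm_term (real P) a b u = kin u"
  by (intro ext) (simp add: norm_term_def kin_def abs_powr_P)

lemma Espace_eq: "Espace (real P) a b = E"
  by (simp add: Espace_def E_def norm_term_eq)

lemma log_term_eq: "log_term q r c u = (\<lambda>n. c n * eta (u n))"
  by (intro ext) (simp add: log_term_def eta_def)

lemma Dspace_eq: "Dspace (real P) q r a b c = E"
  using E_eta_summable by (auto simp: Dspace_def Espace_eq log_term_eq)

lemma Ifun_eq: "Ifun (real P) q r a b c u = J u"
  by (simp add: Ifun_def J_def normp_def norm_term_eq K_def A_def B_def log_term_eq)

lemma dI_eq: "dI (real P) q r a b c u v = dJ u v"
proof -
  have 1: "a n * \<bar>fdiff u n\<bar> powr (real P - 2) * fdiff u n * fdiff v n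
      + b n * \<bar>u n\<bar> powr (real P - 2) * u n * v n = dkin u v n" for n
    using abs_powr_P2[of "fdiff u n"] abs_powr_P2[of "u n"] by (simp add: dkin_def mult.assoc)
  have 2: "(if u n = 0 then 0 else c n * \<bar>u n\<bar> powr (q - 2) * u n * v n * ln (\<bar>u n\<bar> powr r)) = c n * psi (u n) * v n" for n
    by (simp add: psi_def)
  show ?thesis unfolding dI_def dJ_def dK_def dB_def 1 2 ..
qed

subsection \<open>The fibering maps\<close>

definition M :: "(int \<Rightarrow> real) set" where
  "M = {u \<in> E. pos_part u \<noteq> (\<lambda>_. 0) \<and> neg_part u \<noteq> (\<lambda>_. 0) \<and> dJ u (pos_part u) = 0 \<and> dJ u (neg_part u) = 0}"

lemma signNehari_eq: "signNehari (real P) q r a b c = M"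
  by (auto simp: signNehari_def M_def Dspace_eq dI_eq)

lemma comb_in_E: "u \<in> E \<Longrightarrow> comb s t u \<in> E"
  unfolding comb_eq_rescale by (rule rescale_in_E[OF _ nodal_sign])

lemma pos_part_in_E: "u \<in> E \<Longrightarrow> pos_part u \<in> E"
  unfolding pos_part_eq_piece by (rule piece_in_E[OF _ nodal_sign])

lemma neg_part_in_E: "u \<in> E \<Longrightarrow> neg_part u \<in> E"
  unfolding neg_part_eq_piece by (rule piece_in_E[OF _ nodal_sign])

lemma
  assumes u: "u \<in> M" and st: "0 \<le> s" "0 \<le> t"
  shows J_comb_le: "J (comb s t u) \<le> J u"
    and J_comb_less: "s \<noteq> 1 \<or> t \<noteq> 1 \<Longrightarrow> J (comb s t u) < J u"
proof -
  have uE: "u \<in> E" using u by (simp add: M_def)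
  have crit: "dJ u (piece (\<lambda>n. 0 < u n) u i) = 0" for i
    using u by (cases i) (auto simp: M_def pos_part_eq_piece neg_part_eq_piece)
  have st': "0 \<le> (if i then s else t)" for i using st by simp
  show "J (comb s t u) \<le> J u"
    unfolding comb_eq_rescale by (rule J_rescale_le[OF uE nodal_sign crit st'])
  assume "s \<noteq> 1 \<or> t \<noteq> 1"
  then show "J (comb s t u) < J u"
  proof
    assume "s \<noteq> 1"
    then show ?thesis unfolding comb_eq_rescale using u
      by (intro J_rescale_less[OF uE nodal_sign crit st', where i = True]) (auto simp: M_def pos_part_eq_piece)
  next
    assume "t \<noteq> 1"
    then show ?thesis unfolding comb_eq_rescale using u
      by (intro J_rescale_less[OF uE nodal_sign crit st', where i = False]) (auto simp: M_def neg_part_eq_piece)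
  qed
qed

lemma J_comb:
  assumes "u \<in> E" "0 \<le> s" "0 \<le> t"
  shows "J (comb s t u) = K (comb s t u) / real P
    + log_part (A (pos_part u)) (B (pos_part u)) s + log_part (A (neg_part u)) (B (neg_part u)) t"
  unfolding comb_eq_rescale
  by (subst J_rescale[OF assms(1) nodal_sign])
     (use assms in \<open>auto simp: UNIV_bool pos_part_eq_piece neg_part_eq_piece\<close>)

lemma K_comb_le:
  assumes "u \<in> E"
  shows "K (comb s t u) \<le> s ^ P * dK u (pos_part u) + t ^ P * dK u (neg_part u)"
  using K_rescale_le[OF assms nodal_sign, of "\<lambda>i. if i then s else t"]
  by (simp add: comb_eq_rescale UNIV_bool pos_part_eq_piece neg_part_eq_piece)

lemma kin_scale: "kin (\<lambda>n. s * u n) n = s ^ P * kin u n"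
proof -
  have "fdiff (\<lambda>n. s * u n) n = s * fdiff u n" by (simp add: fdiff_def algebra_simps)
  then show ?thesis by (simp add: kin_def power_mult_distrib algebra_simps)
qed

lemma K_scale: "K (\<lambda>n. s * u n) = s ^ P * K u"
  by (simp add: K_def kin_scale[abs_def] infsum_cmult_right' kin_scale)

text \<open>Positive and negative parts are both nondecreasing functions of the value, so their
  differences across an edge have a common sign and even powers are superadditive. This lower bound
  excludes maxima of the fibering map on the coordinate axes.\<close>

lemma kin_comb_ge:
  assumes "0 \<le> s" "0 \<le> t"
  shows "s ^ P * kin (pos_part u) n + t ^ P * kin (neg_part u) n \<le> kin (comb s t u) n"
proof -
  have 1: "0 \<le> fdiff (pos_part u) n * fdiff (neg_part u) n"
    by (auto simp: fdiff_def pos_part_def neg_part_def zero_le_mult_iff max_def min_def)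
  have "(s * fdiff (pos_part u) n) ^ P + (t * fdiff (neg_part u) n) ^ P
      \<le> (s * fdiff (pos_part u) n + t * fdiff (neg_part u) n) ^ P"
    using mult_nonneg_nonneg[OF mult_nonneg_nonneg[OF assms] 1]
    by (intro even_power_superadditive[OF P_even P_ge1]) (simp add: mult_ac)
  also have "s * fdiff (pos_part u) n + t * fdiff (neg_part u) n = fdiff (comb s t u) n"
    by (simp add: fdiff_def comb_def algebra_simps)
  finally have "a n * ((s * fdiff (pos_part u) n) ^ P + (t * fdiff (neg_part u) n) ^ P) \<le> a n * fdiff (comb s t u) n ^ P"
    using a_pos[of n] by (intro mult_left_mono) auto
  moreover have "pos_part u n * neg_part u n = 0" by (auto simp: pos_part_def neg_part_def max_def min_def)
  then have "(s * pos_part u n) ^ P + (t * neg_part u n) ^ P \<le> (s * pos_part u n + t * neg_part u n) ^ P"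
    by (intro even_power_superadditive[OF P_even P_ge1]) auto
  then have "b n * ((s * pos_part u n) ^ P + (t * neg_part u n) ^ P) \<le> b n * comb s t u n ^ P"
    using b_pos[of n] by (intro mult_left_mono) (auto simp: comb_def)
  ultimately show ?thesis by (simp add: kin_def power_mult_distrib algebra_simps)
qed

lemma K_comb_ge:
  assumes "u \<in> E" "0 \<le> s" "0 \<le> t"
  shows "s ^ P * K (pos_part u) + t ^ P * K (neg_part u) \<le> K (comb s t u)"
proof -
  have s: "kin (pos_part u) summable_on UNIV" "kin (neg_part u) summable_on UNIV" "kin (comb s t u) summable_on UNIV"
    using pos_part_in_E[OF assms(1)] neg_part_in_E[OF assms(1)] comb_in_E[OF assms(1)] by (auto simp: E_def)
  have "s ^ P * K (pos_part u) + t ^ P * K (neg_part u)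
      = (\<Sum>\<^sub>\<infinity>n. s ^ P * kin (pos_part u) n + t ^ P * kin (neg_part u) n)"
    using s by (simp add: K_def infsum_add summable_on_cmult_right infsum_cmult_right')
  also have "\<dots> \<le> K (comb s t u)"
    unfolding K_def using s
    by (intro infsum_mono summable_on_add summable_on_cmult_right kin_comb_ge assms)
  finally show ?thesis .
qed

lemma K_comb_0: "K (comb 0 t u) = t ^ P * K (neg_part u)" "K (comb s 0 u) = s ^ P * K (pos_part u)"
  using K_scale[of t "neg_part u"] K_scale[of s "pos_part u"] by (simp_all add: comb_def[abs_def])

lemma kin_convex:
  assumes "0 \<le> \<alpha>" "0 \<le> \<beta>" "\<alpha> + \<beta> = 1"
  shows "kin (\<lambda>n. \<alpha> * u n + \<beta> * v n) n \<le> \<alpha> * kin u n + \<beta> * kin v n"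
proof -
  have cv: "(\<alpha> * x + \<beta> * y) ^ P \<le> \<alpha> * x ^ P + \<beta> * y ^ P" for x y :: real
    using convex_power_even[OF P_even] assms unfolding convex_on_def by auto
  have "fdiff (\<lambda>n. \<alpha> * u n + \<beta> * v n) n = \<alpha> * fdiff u n + \<beta> * fdiff v n"
    by (simp add: fdiff_def algebra_simps)
  then have "a n * fdiff (\<lambda>n. \<alpha> * u n + \<beta> * v n) n ^ P \<le> a n * (\<alpha> * fdiff u n ^ P + \<beta> * fdiff v n ^ P)"
    using cv a_pos[of n] by (simp add: mult_left_mono)
  moreover have "b n * (\<alpha> * u n + \<beta> * v n) ^ P \<le> b n * (\<alpha> * u n ^ P + \<beta> * v n ^ P)"
    using cv b_pos[of n] by (simp add: mult_left_mono)
  ultimately show ?thesis by (simp add: kin_def algebra_simps)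
qed

text \<open>The sequence depends linearly on \<open>(s, t)\<close> and \<open>K\<close> is convex; a
  finite convex function on the open plane is continuous.\<close>

lemma continuous_K_comb:
  assumes "u \<in> E"
  shows "continuous_on UNIV (\<lambda>z. K (comb (fst z) (snd z) u))"
proof (rule convex_on_continuous[OF open_UNIV])
  show "convex_on UNIV (\<lambda>z. K (comb (fst z) (snd z) u))"
    unfolding convex_on_def
  proof (intro conjI convex_UNIV ballI allI impI)
    fix x y :: "real \<times> real" and \<alpha> \<beta> :: real
    assume ab: "0 \<le> \<alpha>" "0 \<le> \<beta>" "\<alpha> + \<beta> = 1"
    have e: "comb (fst (\<alpha> *\<^sub>R x + \<beta> *\<^sub>R y)) (snd (\<alpha> *\<^sub>R x + \<beta> *\<^sub>R y)) u
        = (\<lambda>n. \<alpha> * comb (fst x) (snd x) u n + \<beta> * comb (fst y) (snd y) u n)"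
      by (intro ext) (simp add: comb_def algebra_simps)
    have s: "kin (comb s t u) summable_on UNIV" for s t
      using comb_in_E[OF assms] by (simp add: E_def)
    have "K (comb (fst (\<alpha> *\<^sub>R x + \<beta> *\<^sub>R y)) (snd (\<alpha> *\<^sub>R x + \<beta> *\<^sub>R y)) u)
        \<le> (\<Sum>\<^sub>\<infinity>n. \<alpha> * kin (comb (fst x) (snd x) u) n + \<beta> * kin (comb (fst y) (snd y) u) n)"
      unfolding K_def
      by (intro infsum_mono s summable_on_add summable_on_cmult_right) (unfold e, rule kin_convex[OF ab])
    also have "\<dots> = \<alpha> * K (comb (fst x) (snd x) u) + \<beta> * K (comb (fst y) (snd y) u)"
      by (simp add: K_def infsum_add s summable_on_cmult_right infsum_cmult_right')
    finally show "K (comb (fst (\<alpha> *\<^sub>R x + \<beta> *\<^sub>R y)) (snd (\<alpha> *\<^sub>R x + \<beta> *\<^sub>R y)) u)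
        \<le> \<alpha> * K (comb (fst x) (snd x) u) + \<beta> * K (comb (fst y) (snd y) u)" .
  qed
qed

lemma continuous_log_part: "continuous_on {0..} (log_part \<alpha> \<beta>)"
proof -
  have "continuous_on {0..} (\<lambda>s::real. \<bar>s\<bar> powr q)" "continuous_on {0..} (abs_powr_ln q)"
    using q_gt2 isCont_abs_powr[of q] isCont_abs_powr_ln[of q] by (simp_all add: continuous_at_imp_continuous_on)
  then have "continuous_on {0..} (\<lambda>s. (r / q\<^sup>2 * \<alpha> - \<beta> / q) * \<bar>s\<bar> powr q - (r * \<alpha> / q) * abs_powr_ln q s)"
    by (intro continuous_on_diff continuous_on_mult_left)
  then show ?thesis
    by (rule continuous_on_eq) (simp add: log_part_def abs_powr_ln_def add_divide_distrib algebra_simps)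
qed

lemma continuous_J_comb:
  assumes "u \<in> E"
  shows "continuous_on ({0..} \<times> {0..}) (\<lambda>z. J (comb (fst z) (snd z) u))"
proof -
  have "continuous_on ({0..} \<times> {0..}) (\<lambda>z. K (comb (fst z) (snd z) u) / real P
    + log_part (A (pos_part u)) (B (pos_part u)) (fst z) + log_part (A (neg_part u)) (B (neg_part u)) (snd z))"
    using P_ge continuous_on_subset[OF continuous_K_comb[OF assms]]
    by (intro continuous_intros continuous_on_compose2[OF continuous_log_part]) auto
  then show ?thesis by (rule continuous_on_eq) (auto simp: J_comb[OF assms])
qed

lemma kin_above_tangent: "kin u n + real P * h * dkin u v n \<le> kin (\<lambda>n. u n + h * v n) n"
proof -
  have f: "fdiff (\<lambda>n. u n + h * v n) n = fdiff u n + h * fdiff v n"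
    by (simp add: fdiff_def algebra_simps)
  have "a n * (fdiff u n ^ P + real P * (h * fdiff v n) * fdiff u n ^ (P - 1)) \<le> a n * (fdiff u n + h * fdiff v n) ^ P"
    "b n * (u n ^ P + real P * (h * v n) * u n ^ (P - 1)) \<le> b n * (u n + h * v n) ^ P"
    using a_pos[of n] b_pos[of n] by (intro mult_left_mono even_power_above_tangent P_even; simp)+
  then show ?thesis by (simp add: kin_def dkin_def f algebra_simps)
qed

text \<open>No differentiation under the infinite sum is needed: by convexity the kinetic energy lies above its
  tangent, so that the explicit lower bound \<open>f\<close> inherits the local maximum at 1.\<close>

lemma critical_of_local_max:
  fixes \<kappa> :: "int \<Rightarrow> 'i::finite"
  assumes z: "z \<in> E" "nodal \<kappa> z" and \<delta>: "0 < \<delta>"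
    and max: "\<And>s. \<bar>s - 1\<bar> < \<delta> \<Longrightarrow> J (rescale \<kappa> (\<lambda>j. if j = i then s else 1) z) \<le> J z"
  shows "dJ z (piece \<kappa> z i) = 0"
proof -
  define v \<alpha> \<beta> where "v = piece \<kappa> z i" and "\<alpha> = A v" and "\<beta> = B v"
  define f where "f s = (s - 1) * dK z v + log_part \<alpha> \<beta> s" for s
  have f_le: "f s \<le> f 1" if s: "0 \<le> s" "\<bar>s - 1\<bar> < \<delta>" for s
  proof -
    let ?\<sigma> = "\<lambda>j. if j = i then s else 1"
    let ?L = "\<lambda>j. log_part (A (piece \<kappa> z j)) (B (piece \<kappa> z j))"
    have e: "rescale \<kappa> ?\<sigma> z = (\<lambda>n. z n + (s - 1) * v n)"
      by (auto simp: rescale_def v_def piece_def algebra_simps)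
    have "K z + real P * (s - 1) * dK z v = (\<Sum>\<^sub>\<infinity>n. kin z n + real P * (s - 1) * dkin z v n)"
      using z(1) dkin_piece_summable[OF z, of i]
      by (simp add: K_def dK_def v_def E_def infsum_add summable_on_cmult_right infsum_cmult_right')
    also have "\<dots> \<le> K (rescale \<kappa> ?\<sigma> z)"
      unfolding K_def using z(1) dkin_piece_summable[OF z, of i] rescale_in_E[OF z, of ?\<sigma>]
      by (intro infsum_mono summable_on_add summable_on_cmult_right)
         (auto simp: E_def v_def[symmetric] e intro: kin_above_tangent)
    finally have "(K z + real P * (s - 1) * dK z v) / real P \<le> K (rescale \<kappa> ?\<sigma> z) / real P"
      by (rule divide_right_mono) simp
    then have "K z / real P + (s - 1) * dK z v \<le> K (rescale \<kappa> ?\<sigma> z) / real P"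
      using P_ge by (simp add: add_divide_distrib)
    moreover have "J (rescale \<kappa> ?\<sigma> z) = K (rescale \<kappa> ?\<sigma> z) / real P + (\<Sum>j\<in>UNIV. ?L j (?\<sigma> j))"
      using s by (intro J_rescale[OF z]) auto
    moreover have "(\<Sum>j\<in>UNIV. ?L j (?\<sigma> j)) = log_part \<alpha> \<beta> s + (\<Sum>j\<in>UNIV - {i}. ?L j 1)"
    proof -
      have "(\<Sum>j\<in>UNIV. ?L j (?\<sigma> j)) = ?L i (?\<sigma> i) + (\<Sum>j\<in>UNIV - {i}. ?L j (?\<sigma> j))"
        by (rule sum.remove) auto
      also have "(\<Sum>j\<in>UNIV - {i}. ?L j (?\<sigma> j)) = (\<Sum>j\<in>UNIV - {i}. ?L j 1)"
        by (intro sum.cong) auto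
      finally show ?thesis by (simp add: \<alpha>_def \<beta>_def v_def)
    qed
    moreover have "J z = K z / real P + (\<Sum>j\<in>UNIV. ?L j 1)"
      using J_rescale[OF z, of "\<lambda>_. 1"] by (simp add: rescale_1)
    moreover have "(\<Sum>j\<in>UNIV. ?L j 1) = log_part \<alpha> \<beta> 1 + (\<Sum>j\<in>UNIV - {i}. ?L j 1)"
      unfolding \<alpha>_def \<beta>_def v_def by (rule sum.remove) auto
    ultimately show ?thesis using max[OF s(2)] by (simp add: f_def)
  qed
  \<comment> \<open>In these constants \<open>log_part \<alpha> \<beta> s\<close> is
    \<open>C * s powr q - D * (s powr q * ln s)\<close>. Its derivative at 1 is
    \<open>C * q - D\<close>, in which the \<open>\<alpha>\<close> terms cancel.\<close>
  define C D where "C = r / q\<^sup>2 * \<alpha> - \<beta> / q" and "D = r * \<alpha> / q"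
  have "f = (\<lambda>s. (s - 1) * dK z v + (C * s powr q - D * (s powr q * ln s)))"
    by (intro ext) (simp add: f_def log_part_def C_def D_def add_divide_distrib algebra_simps)
  moreover have "((\<lambda>s. (s - 1) * dK z v + (C * s powr q - D * (s powr q * ln s)))
      has_real_derivative (dK z v + (C * q - D))) (at 1)"
    by (auto intro!: derivative_eq_intros)
  moreover have "C * q - D = - \<beta>"
    using q_gt2 by (simp add: C_def D_def field_simps power2_eq_square)
  ultimately have "(f has_real_derivative (dK z v - \<beta>)) (at 1)" by simp
  \<comment> \<open>The radius is capped at 1 to keep the scale factor nonnegative.\<close>
  moreover have "\<forall>y. \<bar>1 - y\<bar> < min \<delta> 1 \<longrightarrow> f y \<le> f 1" using f_le by (auto simp: abs_minus_commute)
  moreover have "0 < min \<delta> 1" using \<delta> by simp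
  ultimately have "dK z v - \<beta> = 0" by (blast intro: DERIV_local_max)
  then show ?thesis by (simp add: dJ_def v_def \<beta>_def dB_piece[OF z])
qed

text \<open>Scaling one sign part of \<open>comb s t u\<close> by \<open>x\<close> moves one
  coordinate to \<open>x * s\<close> or \<open>x * t\<close>. A local maximum in
  \<open>(s, t)\<close> is therefore one for each part separately, and each gives one
  constraint.\<close>

lemma comb_in_M:
  assumes u: "u \<in> E" "pos_part u \<noteq> (\<lambda>_. 0)" "neg_part u \<noteq> (\<lambda>_. 0)"
    and st: "0 < s" "0 < t" and \<delta>: "0 < \<delta>"
    and max: "\<And>s' t'. \<bar>s' - s\<bar> < \<delta> \<Longrightarrow> \<bar>t' - t\<bar> < \<delta> \<Longrightarrow> J (comb s' t' u) \<le> J (comb s t u)"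
  shows "comb s t u \<in> M"
proof -
  define z where "z = comb s t u"
  have zE: "z \<in> E" unfolding z_def by (rule comb_in_E[OF u(1)])
  have cz: "comb s' t' z = comb (s' * s) (t' * t) u" for s' t'
    unfolding z_def using st by (intro comb_comb) auto
  \<comment> \<open>Dividing by \<open>s + t\<close> serves both coordinates, since each of
    \<open>s\<close> and \<open>t\<close> is at most the sum.\<close>
  define \<epsilon> where "\<epsilon> = \<delta> / (s + t)"
  have \<epsilon>: "0 < \<epsilon>" using \<delta> st by (simp add: \<epsilon>_def)
  have es: "\<bar>x * s - s\<bar> < \<delta>" "\<bar>x * t - t\<bar> < \<delta>" if "\<bar>x - 1\<bar> < \<epsilon>" for x
  proof -
    have 1: "\<bar>x - 1\<bar> * (s + t) < \<delta>" using that st by (simp add: \<epsilon>_def field_simps)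
    have 2: "\<bar>x - 1\<bar> * s \<le> \<bar>x - 1\<bar> * (s + t)" "\<bar>x - 1\<bar> * t \<le> \<bar>x - 1\<bar> * (s + t)"
      using st by (auto intro!: mult_left_mono)
    have "\<bar>x * s - s\<bar> = \<bar>x - 1\<bar> * s" "\<bar>x * t - t\<bar> = \<bar>x - 1\<bar> * t"
      using st abs_mult[of "x - 1" s] abs_mult[of "x - 1" t] by (simp_all add: algebra_simps)
    with 1 2 show "\<bar>x * s - s\<bar> < \<delta>" "\<bar>x * t - t\<bar> < \<delta>" by linarith+
  qed
  have "dJ z (pos_part z) = 0"
    unfolding pos_part_eq_piece
  proof (rule critical_of_local_max[OF zE nodal_sign \<epsilon>])
    fix x assume "\<bar>x - 1\<bar> < \<epsilon>"
    from max[OF es(1)[OF this], of t] show "J (rescale (\<lambda>n. 0 < z n) (\<lambda>j. if j = True then x else 1) z) \<le> J z"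
      using cz[of x 1] \<delta> by (simp add: comb_eq_rescale[of x 1, symmetric]) (simp add: z_def)
  qed
  moreover have "dJ z (neg_part z) = 0"
    unfolding neg_part_eq_piece
  proof (rule critical_of_local_max[OF zE nodal_sign \<epsilon>])
    fix x assume x: "\<bar>x - 1\<bar> < \<epsilon>"
    have e: "(\<lambda>j. if j = False then x else 1) = (\<lambda>j. if j then 1 else x)" by auto
    from max[OF _ es(2)[OF x], of s] show "J (rescale (\<lambda>n. 0 < z n) (\<lambda>j. if j = False then x else 1) z) \<le> J z"
      using cz[of 1 x] \<delta> unfolding e by (simp add: comb_eq_rescale[of 1 x, symmetric]) (simp add: z_def)
  qed
  moreover have "pos_part z \<noteq> (\<lambda>_. 0)" "neg_part z \<noteq> (\<lambda>_. 0)"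
    using u st by (auto simp: z_def pos_part_comb neg_part_comb fun_eq_iff)
  ultimately show ?thesis using zE unfolding M_def z_def by simp
qed

section \<open>Location of the maximum of the fibering map\<close>

lemma log_part_coercive:
  assumes "0 \<le> k" "0 < \<alpha>" "0 \<le> N"
  obtains R where "1 \<le> R" "\<And>s. R \<le> s \<Longrightarrow> s ^ P * k + log_part \<alpha> \<beta> s \<le> - N"
proof -
  have q: "0 < q" using q_gt2 by simp
  \<comment> \<open>For \<open>s \<ge> 1\<close> all terms without \<open>ln s\<close>, together
    with \<open>N\<close>, are at most \<open>D * s powr q\<close>. The threshold \<open>R\<close>
    is where the coefficient of the negative logarithmic term reaches \<open>D\<close>.\<close>
  define D where "D = k + r / q\<^sup>2 * \<alpha> + \<bar>\<beta>\<bar> / q + N"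
  define R where "R = exp (D * q / (r * \<alpha>))"
  have r0: "0 < r * \<alpha>" using r_ge assms by simp
  have D0: "0 \<le> D" using assms r_ge q by (simp add: D_def)
  have R: "1 \<le> R" unfolding R_def using D0 r0 q by simp
  have "s ^ P * k + log_part \<alpha> \<beta> s \<le> - N" if s: "R \<le> s" for s
  proof -
    have s1: "1 \<le> s" using R s by simp
    define y where "y = s powr q"
    have y1: "1 \<le> y" unfolding y_def using s1 q by (simp add: ge_one_powr_ge_zero)
    have "D * q / (r * \<alpha>) \<le> ln s" using s s1 unfolding R_def by (simp add: ln_ge_iff)
    then have Dl: "D \<le> r * ln s * \<alpha> / q" using r0 q by (simp add: field_simps)
    have "s ^ P \<le> y" unfolding y_def powr_realpow[symmetric, OF order_less_le_trans[OF zero_less_one s1]]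
      using s1 P_less_q by (intro powr_mono) auto
    then have "s ^ P * k \<le> y * k" using assms by (intro mult_right_mono)
    moreover have "- \<beta> / q \<le> \<bar>\<beta>\<bar> / q" using q by (intro divide_right_mono) auto
    then have "y * (- \<beta> / q) \<le> y * (\<bar>\<beta>\<bar> / q)" using y1 by (intro mult_left_mono) auto
    moreover have "log_part \<alpha> \<beta> s = y * (r / q\<^sup>2 * \<alpha>) + y * (- \<beta> / q) - y * (r * ln s * \<alpha> / q)"
      unfolding log_part_def y_def[symmetric]
      by (simp add: add_divide_distrib algebra_simps)
    moreover have "y * D \<le> y * (r * ln s * \<alpha> / q)" using Dl y1 by (intro mult_left_mono) auto
    moreover have "1 * N \<le> y * N" using y1 assms by (intro mult_right_mono)
    ultimately show ?thesis by (simp add: D_def algebra_simps)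
  qed
  then show thesis using R that by blast
qed

lemma log_part_bounded_above:
  assumes "0 \<le> k" "0 < \<alpha>"
  obtains S where "0 \<le> S" "\<And>s. 0 \<le> s \<Longrightarrow> s ^ P * k + log_part \<alpha> \<beta> s \<le> S"
proof -
  obtain R where R: "1 \<le> R" "\<And>s. R \<le> s \<Longrightarrow> s ^ P * k + log_part \<alpha> \<beta> s \<le> - 0"
    using log_part_coercive[OF assms order_refl, of \<beta>] by metis
  have "compact {0..R}" "{0..R} \<noteq> {}" using R(1) by auto
  moreover have "continuous_on {0..R} (\<lambda>s. s ^ P * k + log_part \<alpha> \<beta> s)"
    by (intro continuous_intros continuous_on_subset[OF continuous_log_part]) auto
  ultimately obtain x where x: "x \<in> {0..R}" "\<forall>s\<in>{0..R}. s ^ P * k + log_part \<alpha> \<beta> s \<le> x ^ P * k + log_part \<alpha> \<beta> x"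
    using continuous_attains_sup[of "{0..R}" "\<lambda>s. s ^ P * k + log_part \<alpha> \<beta> s"] by blast
  show thesis
  proof (rule that)
    show "0 \<le> max 0 (x ^ P * k + log_part \<alpha> \<beta> x)" by simp
    fix s :: real assume "0 \<le> s"
    then show "s ^ P * k + log_part \<alpha> \<beta> s \<le> max 0 (x ^ P * k + log_part \<alpha> \<beta> x)"
      using bspec[OF x(2), of s] R(2)[of s] by (cases "s \<le> R") auto
  qed
qed

text \<open>For \<open>s < 1\<close> both \<open>\<alpha>\<close> terms are nonnegative, so only the
  \<open>\<beta>\<close> term can be harmful; it is of order \<open>s powr q\<close>, negligible
  against \<open>s ^ P\<close>.\<close>

lemma log_part_small:
  assumes "0 < k" "0 \<le> \<alpha>" "0 < R"
  obtains s where "0 < s" "s < R" "0 < s ^ P * k + log_part \<alpha> \<beta> s"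
proof -
  have q: "0 < q" using q_gt2 by simp
  have "((\<lambda>s. s powr (q - real P) * (\<bar>\<beta>\<bar> / q)) \<longlongrightarrow> 0 powr (q - real P) * (\<bar>\<beta>\<bar> / q)) (at_right (0::real))"
    using P_less_q by (intro tendsto_intros) (auto intro: eventually_mono[OF eventually_at_right_less])
  then have "((\<lambda>s. s powr (q - real P) * (\<bar>\<beta>\<bar> / q)) \<longlongrightarrow> 0) (at_right (0::real))" by simp
  from order_tendstoD(2)[OF this assms(1)]
  have ev: "\<forall>\<^sub>F s in at_right 0. s powr (q - real P) * (\<bar>\<beta>\<bar> / q) < k" .
  have "\<forall>\<^sub>F s in at_right 0. s \<in> {0<..<min R 1}"
    using assms(3) by (intro eventually_at_right_real) auto
  from eventually_happens'[OF _ eventually_conj[OF ev this]]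
  obtain s where s: "s powr (q - real P) * (\<bar>\<beta>\<bar> / q) < k" "0 < s" "s < R" "s < 1" by auto
  have sq: "s powr q = s ^ P * s powr (q - real P)"
    using s(2) by (simp add: powr_realpow[symmetric] powr_add[symmetric])
  have "s ^ P * (s powr (q - real P) * (\<bar>\<beta>\<bar> / q)) < s ^ P * k"
    using s by (intro mult_strict_left_mono) auto
  then have "s powr q * (\<bar>\<beta>\<bar> / q) < s ^ P * k" by (simp only: sq mult.assoc)
  moreover have "s powr q * (\<beta> / q) \<le> s powr q * (\<bar>\<beta>\<bar> / q)"
    using q by (intro mult_left_mono divide_right_mono) auto
  moreover have "0 \<le> r / q\<^sup>2 * (s powr q * \<alpha>)" using r_ge assms by simp
  moreover have "0 \<le> r * (s powr q * - ln s) * \<alpha> / q"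
    using r_ge assms s q by (intro divide_nonneg_pos mult_nonneg_nonneg) auto
  moreover have "log_part \<alpha> \<beta> s = r / q\<^sup>2 * (s powr q * \<alpha>) - s powr q * (\<beta> / q) + r * (s powr q * - ln s) * \<alpha> / q"
    unfolding log_part_def by (simp add: diff_divide_distrib add_divide_distrib)
  moreover have "x < y \<Longrightarrow> x' \<le> x \<Longrightarrow> 0 \<le> z \<Longrightarrow> 0 \<le> w \<Longrightarrow> v = z - x' + w \<Longrightarrow> 0 < y + v"
    for x x' y z w v :: real by linarith
  ultimately have "0 < s ^ P * k + log_part \<alpha> \<beta> s" by blast
  then show thesis using that s by blast
qed

text \<open>A maximum over a large box is interior: on the outer sides \<open>J\<close> is negative,
  whereas the origin gives 0; on a coordinate axis, switching on a little of the missing part raises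
  \<open>J\<close>.\<close>

lemma exists_comb_in_M:
  assumes u: "u \<in> E" "pos_part u \<noteq> (\<lambda>_. 0)" "neg_part u \<noteq> (\<lambda>_. 0)"
  obtains s t where "0 < s" "0 < t" "comb s t u \<in> M"
proof -
  define k1 k2 \<alpha>1 \<alpha>2 \<beta>1 \<beta>2 where "k1 = dK u (pos_part u) / real P" and "k2 = dK u (neg_part u) / real P"
    and "\<alpha>1 = A (pos_part u)" and "\<alpha>2 = A (neg_part u)" and "\<beta>1 = B (pos_part u)" and "\<beta>2 = B (neg_part u)"
  have P0: "0 < real P" using P_ge by simp
  have k: "0 \<le> k1" "0 \<le> k2"
    using K_piece_le[OF u(1) nodal_sign, of True] K_piece_le[OF u(1) nodal_sign, of False] K_nonneg[of "pos_part u"]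
      K_nonneg[of "neg_part u"] P0
    by (auto simp: k1_def k2_def pos_part_eq_piece neg_part_eq_piece)
  have \<alpha>: "0 < \<alpha>1" "0 < \<alpha>2" using A_pos pos_part_in_E neg_part_in_E u by (auto simp: \<alpha>1_def \<alpha>2_def)
  let ?g1 = "\<lambda>s. s ^ P * k1 + log_part \<alpha>1 \<beta>1 s" and ?g2 = "\<lambda>s. s ^ P * k2 + log_part \<alpha>2 \<beta>2 s"
  have J_le: "J (comb s t u) \<le> ?g1 s + ?g2 t" if "0 \<le> s" "0 \<le> t" for s t
    using J_comb[OF u(1) that] divide_right_mono[OF K_comb_le[OF u(1), of s t], of "real P"] P0
    by (simp add: k1_def k2_def \<alpha>1_def \<alpha>2_def \<beta>1_def \<beta>2_def add_divide_distrib)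
  obtain S1 where S1: "0 \<le> S1" "\<And>s. 0 \<le> s \<Longrightarrow> ?g1 s \<le> S1" using log_part_bounded_above[OF k(1) \<alpha>(1), of \<beta>1] by metis
  obtain S2 where S2: "0 \<le> S2" "\<And>s. 0 \<le> s \<Longrightarrow> ?g2 s \<le> S2" using log_part_bounded_above[OF k(2) \<alpha>(2), of \<beta>2] by metis
  have "0 \<le> S2 + 1" "0 \<le> S1 + 1" using S1 S2 by auto
  \<comment> \<open>Beyond \<open>R1\<close> the first summand outweighs the largest value
    \<open>S2\<close> of the second, whatever \<open>t\<close> is; \<open>R2\<close> plays the
    symmetric role.\<close>
  obtain R1 where R1: "1 \<le> R1" "\<And>s. R1 \<le> s \<Longrightarrow> ?g1 s \<le> - (S2 + 1)"
    using log_part_coercive[OF k(1) \<alpha>(1) \<open>0 \<le> S2 + 1\<close>, of \<beta>1] by metis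
  obtain R2 where R2: "1 \<le> R2" "\<And>s. R2 \<le> s \<Longrightarrow> ?g2 s \<le> - (S1 + 1)"
    using log_part_coercive[OF k(2) \<alpha>(2) \<open>0 \<le> S1 + 1\<close>, of \<beta>2] by metis
  have neg: "J (comb s t u) < 0" if "0 \<le> s" "0 \<le> t" "R1 \<le> s \<or> R2 \<le> t" for s t
    using that(3) J_le[OF that(1,2)] S1(2)[OF that(1)] S2(2)[OF that(2)] R1(2)[of s] R2(2)[of t] by auto
  have "compact ({0..R1} \<times> {0..R2})" "{0..R1} \<times> {0..R2} \<noteq> {}" using R1(1) R2(1) by (auto intro: compact_Times)
  moreover have "continuous_on ({0..R1} \<times> {0..R2}) (\<lambda>z. J (comb (fst z) (snd z) u))"
    by (rule continuous_on_subset[OF continuous_J_comb[OF u(1)]]) auto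
  ultimately obtain z where z: "z \<in> {0..R1} \<times> {0..R2}"
    "\<forall>y \<in> {0..R1} \<times> {0..R2}. J (comb (fst y) (snd y) u) \<le> J (comb (fst z) (snd z) u)"
    using continuous_attains_sup[of "{0..R1} \<times> {0..R2}" "\<lambda>z. J (comb (fst z) (snd z) u)"] by blast
  obtain s0 t0 where z0: "z = (s0, t0)" by (cases z)
  have st0: "0 \<le> s0" "s0 \<le> R1" "0 \<le> t0" "t0 \<le> R2" using z(1) by (auto simp: z0)
  have max: "J (comb s t u) \<le> J (comb s0 t0 u)" if "0 \<le> s" "s \<le> R1" "0 \<le> t" "t \<le> R2" for s t
    using z(2) that by (auto simp: z0)
  have "J (\<lambda>_. 0) = 0" by (simp add: J_def K_def A_def B_def kin_def[abs_def] fdiff_def[abs_def] power_0_left)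
  then have J0: "0 \<le> J (comb s0 t0 u)" using max[of 0 0] R1 R2 by simp
  have lt: "s0 < R1" "t0 < R2" using neg[OF st0(1,3)] J0 by force+
  have Kpos: "0 < K (pos_part u) / real P" "0 < K (neg_part u) / real P"
    using K_pos pos_part_in_E neg_part_in_E u P0 by auto
  have lp0: "log_part x y 0 = 0" for x y by (simp add: log_part_def)
  have "s0 \<noteq> 0"
  proof
    assume s0: "s0 = 0"
    \<comment> \<open>By \<open>K_comb_ge\<close>, adding \<open>s\<close> times the positive part
      changes \<open>J\<close> by at least this positive amount.\<close>
    obtain s where s: "0 < s" "s < R1" "0 < s ^ P * (K (pos_part u) / real P) + log_part \<alpha>1 \<beta>1 s"
      using log_part_small[OF Kpos(1) less_imp_le[OF \<alpha>(1)], of R1 \<beta>1] R1(1) by auto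
    have "J (comb s t0 u) \<le> J (comb 0 t0 u)" using max[of s t0] s st0 s0 by auto
    moreover have "J (comb 0 t0 u) = t0 ^ P * K (neg_part u) / real P + log_part \<alpha>2 \<beta>2 t0"
      using J_comb[OF u(1), of 0 t0] st0 by (simp add: K_comb_0 lp0 \<alpha>2_def \<beta>2_def)
    moreover have "(s ^ P * K (pos_part u) + t0 ^ P * K (neg_part u)) / real P + log_part \<alpha>1 \<beta>1 s + log_part \<alpha>2 \<beta>2 t0 \<le> J (comb s t0 u)"
      using J_comb[OF u(1), of s t0] st0 s divide_right_mono[OF K_comb_ge[OF u(1), of s t0], of "real P"]
      by (simp add: \<alpha>1_def \<beta>1_def \<alpha>2_def \<beta>2_def)
    ultimately show False using s(3) by (simp add: add_divide_distrib)
  qed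
  moreover have "t0 \<noteq> 0"
  proof
    assume t0: "t0 = 0"
    obtain t where t: "0 < t" "t < R2" "0 < t ^ P * (K (neg_part u) / real P) + log_part \<alpha>2 \<beta>2 t"
      using log_part_small[OF Kpos(2) less_imp_le[OF \<alpha>(2)], of R2 \<beta>2] R2(1) by auto
    have "J (comb s0 t u) \<le> J (comb s0 0 u)" using max[of s0 t] t st0 t0 by auto
    moreover have "J (comb s0 0 u) = s0 ^ P * K (pos_part u) / real P + log_part \<alpha>1 \<beta>1 s0"
      using J_comb[OF u(1), of s0 0] st0 by (simp add: K_comb_0 lp0 \<alpha>1_def \<beta>1_def)
    moreover have "(s0 ^ P * K (pos_part u) + t ^ P * K (neg_part u)) / real P + log_part \<alpha>1 \<beta>1 s0 + log_part \<alpha>2 \<beta>2 t \<le> J (comb s0 t u)"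
      using J_comb[OF u(1), of s0 t] st0 t divide_right_mono[OF K_comb_ge[OF u(1), of s0 t], of "real P"]
      by (simp add: \<alpha>1_def \<beta>1_def \<alpha>2_def \<beta>2_def)
    ultimately show False using t(3) by (simp add: add_divide_distrib)
  qed
  ultimately have pos: "0 < s0" "0 < t0" using st0 by auto
  define \<delta> where "\<delta> = min (min s0 t0) (min (R1 - s0) (R2 - t0))"
  have "0 < \<delta>" using pos lt by (simp add: \<delta>_def)
  then have "comb s0 t0 u \<in> M"
  proof (rule comb_in_M[OF u pos])
    fix s t assume "\<bar>s - s0\<bar> < \<delta>" "\<bar>t - t0\<bar> < \<delta>"
    then show "J (comb s t u) \<le> J (comb s0 t0 u)" by (intro max) (auto simp: \<delta>_def)
  qed
  with pos show thesis using that by blast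
qed

subsection \<open>A minimizer on the sign-changing Nehari set\<close>

lemma eta_nonpos: "\<bar>x\<bar> \<le> 1 \<Longrightarrow> eta x \<le> 0"
proof (cases "x = 0")
  case False
  assume "\<bar>x\<bar> \<le> 1"
  then have "ln (\<bar>x\<bar> powr r) \<le> 0" using False r_ge by (simp add: ln_powr mult_nonneg_nonpos)
  then show ?thesis unfolding eta_def by (intro mult_nonneg_nonpos) auto
qed simp

text \<open>A nonzero piece in equilibrium must exceed 1 somewhere, since its logarithmic energy is positive.
  This keeps both signs alive in the limit of a minimizing sequence.\<close>

lemma piece_exceeds_1:
  fixes \<kappa> :: "int \<Rightarrow> 'i::finite"
  assumes z: "z \<in> E" "nodal \<kappa> z" and crit: "dJ z (piece \<kappa> z i) = 0" and nz: "piece \<kappa> z i \<noteq> (\<lambda>_. 0)"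
  obtains n where "\<kappa> n = i" "1 < \<bar>z n\<bar>"
proof -
  have "0 < K (piece \<kappa> z i)" using K_pos piece_in_E[OF z] nz by auto
  also have "\<dots> \<le> B (piece \<kappa> z i)"
    using K_piece_le[OF z, of i] crit by (simp add: dJ_def dB_piece[OF z])
  finally have "0 < B (piece \<kappa> z i)" .
  have "\<exists>n. 1 < \<bar>piece \<kappa> z i n\<bar>"
  proof (rule ccontr)
    assume "\<nexists>n. 1 < \<bar>piece \<kappa> z i n\<bar>"
    then have "c n * eta (piece \<kappa> z i n) \<le> 0" for n
      using c_pos[of n] eta_nonpos by (intro mult_nonneg_nonpos) (auto simp: not_less)
    then have "B (piece \<kappa> z i) \<le> (\<Sum>\<^sub>\<infinity>n::int. 0)"
      unfolding B_def using E_eta_summable[OF piece_in_E[OF z]] by (intro infsum_mono) auto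
    then show False using \<open>0 < B (piece \<kappa> z i)\<close> by simp
  qed
  then show thesis using that by (auto simp: piece_def split: if_splits)
qed

lemma M_exceeds_1:
  assumes "u \<in> M"
  shows "\<exists>n. 1 < u n" "\<exists>n. u n < -1"
proof -
  have u: "u \<in> E" "dJ u (piece (\<lambda>n. 0 < u n) u True) = 0" "piece (\<lambda>n. 0 < u n) u True \<noteq> (\<lambda>_. 0)"
    "dJ u (piece (\<lambda>n. 0 < u n) u False) = 0" "piece (\<lambda>n. 0 < u n) u False \<noteq> (\<lambda>_. 0)"
    using assms by (auto simp: M_def pos_part_eq_piece neg_part_eq_piece)
  from piece_exceeds_1[OF u(1) nodal_sign u(2,3)] show "\<exists>n. 1 < u n" by (metis abs_of_pos)
  from piece_exceeds_1[OF u(1) nodal_sign u(4,5)] obtain n where n: "(0 < u n) = False" "1 < \<bar>u n\<bar>" by blast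
  then have "u n < -1" by simp
  then show "\<exists>n. u n < -1" ..
qed

text \<open>Adding the two constraints gives \<open>B u = K u\<close>, which removes the only term
  of indefinite sign. On \<open>M\<close> the energy therefore controls \<open>K\<close>.\<close>

lemma J_on_M:
  assumes "u \<in> M"
  shows "J u = (1 / real P - 1 / q) * K u + r / q\<^sup>2 * A u"
proof -
  let ?\<kappa> = "\<lambda>n. 0 < u n"
  have uE: "u \<in> E" and c: "dJ u (pos_part u) = 0" "dJ u (neg_part u) = 0" using assms by (auto simp: M_def)
  have "dK u u = dK u (pos_part u) + dK u (neg_part u)"
    using dK_rescale[OF uE nodal_sign, of "\<lambda>_. 1"]
    by (simp add: rescale_1 UNIV_bool pos_part_eq_piece neg_part_eq_piece)
  moreover have "B u = B (pos_part u) + B (neg_part u)"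
    using B_rescale[OF uE nodal_sign, of "\<lambda>_. 1"]
    by (simp add: rescale_1 UNIV_bool pos_part_eq_piece neg_part_eq_piece)
  moreover have "dB u (pos_part u) = B (pos_part u)" "dB u (neg_part u) = B (neg_part u)"
    using dB_piece[OF uE nodal_sign, of True] dB_piece[OF uE nodal_sign, of False]
    by (simp_all add: pos_part_eq_piece neg_part_eq_piece)
  ultimately have "B u = K u" using c by (simp add: dJ_def dK_self)
  then show ?thesis by (simp add: J_def algebra_simps)
qed

lemma gap_pos: "0 < 1 / real P - 1 / q"
  using P_less_q P_ge by (simp add: field_simps)

lemma K_le_J: assumes "u \<in> M" shows "(1 / real P - 1 / q) * K u \<le> J u"
  using J_on_M[OF assms] A_nonneg[of u] r_ge by simp

lemma J_pos: assumes "u \<in> M" shows "0 < J u"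
proof -
  have "u \<in> E" "u \<noteq> (\<lambda>_. 0)" using assms M_exceeds_1(1)[OF assms] by (auto simp: M_def)
  then have "0 < (1 / real P - 1 / q) * K u" using K_pos gap_pos by simp
  then show ?thesis using K_le_J[OF assms] by linarith
qed

text \<open>The terms \<open>A\<close> and \<open>B\<close> converge, with a multiple of
  \<open>c\<close> as majorant. The bound on \<open>J\<close> thus becomes a convergent bound on
  \<open>K\<close>, and Fatou's lemma gives both membership in \<open>E\<close> and the
  inequality.\<close>

lemma
  fixes u :: "nat \<Rightarrow> int \<Rightarrow> real"
  assumes uE: "\<And>k. u k \<in> E" and bd: "\<And>k n. \<bar>u k n\<bar> \<le> Mb" and lim: "\<And>n. (\<lambda>k. u k n) \<longlonglongrightarrow> v n"
    and le: "\<And>k. J (u k) \<le> C k" and C: "C \<longlonglongrightarrow> C'"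
  shows limit_in_E: "v \<in> E" and J_lower_semicontinuous: "J v \<le> C'"
proof -
  have cont: "(\<lambda>k. \<Sum>\<^sub>\<infinity>n. c n * f (u k n)) \<longlonglongrightarrow> (\<Sum>\<^sub>\<infinity>n. c n * f (v n))"
    if f: "\<And>x. isCont f x" for f :: "real \<Rightarrow> real"
  proof -
    obtain D where D: "\<And>x. \<bar>x\<bar> \<le> Mb \<Longrightarrow> \<bar>f x\<bar> \<le> D" using bounded_on_interval[of f Mb] f by auto
    show ?thesis
    proof (rule tendsto_infsum_dominated(2))
      show "(\<lambda>k. c n * f (u k n)) \<longlonglongrightarrow> c n * f (v n)" for n
        by (intro tendsto_mult tendsto_const isCont_tendsto_compose[OF f] lim)
      show "\<bar>c n * f (u k n)\<bar> \<le> c n * D" for n k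
        using D[OF bd] c_pos[of n] by (simp add: abs_mult)
      show "(\<lambda>n. c n * D) summable_on UNIV" by (intro summable_on_cmult_left c_summable)
    qed
  qed
  have AB: "(\<lambda>k. A (u k)) \<longlonglongrightarrow> A v" "(\<lambda>k. B (u k)) \<longlonglongrightarrow> B v"
    using cont[OF isCont_abs_powr[of q]] cont[OF isCont_eta] q_gt2 by (simp_all add: A_def B_def)
  define F where "F k = real P * (C k - r / q\<^sup>2 * A (u k) + B (u k) / q)" for k
  have F: "F \<longlonglongrightarrow> real P * (C' - r / q\<^sup>2 * A v + B v / q)"
    unfolding F_def using q_gt2 by (intro tendsto_intros AB C) auto
  have KF: "infsum (kin (u k)) UNIV \<le> F k" for k
  proof -
    have "K (u k) = real P * (J (u k) - r / q\<^sup>2 * A (u k) + B (u k) / q)"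
      using P_ge by (simp add: J_def)
    also have "\<dots> \<le> F k" unfolding F_def using le[of k] by (intro mult_left_mono) auto
    finally show ?thesis by (simp add: K_def)
  qed
  have lk: "(\<lambda>k. kin (u k) n) \<longlonglongrightarrow> kin v n" for n
    unfolding kin_def fdiff_def by (intro tendsto_intros lim)
  have s: "kin (u k) summable_on UNIV" for k using uE by (simp add: E_def)
  show "v \<in> E" unfolding E_def mem_Collect_eq
    by (rule infsum_le_of_tendsto(1)[OF lk kin_nonneg s KF F])
  have "K v \<le> real P * (C' - r / q\<^sup>2 * A v + B v / q)"
    unfolding K_def by (rule infsum_le_of_tendsto(2)[OF lk kin_nonneg s KF F])
  then have "K v / real P \<le> C' - r / q\<^sup>2 * A v + B v / q"
    using P_ge by (simp add: field_simps)
  then show "J v \<le> C'" by (simp add: J_def)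
qed

lemma finite_support_in_E:
  assumes "finite {n. v n \<noteq> 0}"
  shows "v \<in> E"
proof -
  \<comment> \<open>The forward difference at \<open>n\<close> sees \<open>n + 1\<close>, so the
    left neighbours of the support also count.\<close>
  let ?S = "{n. v n \<noteq> 0} \<union> (\<lambda>n. n - 1) ` {n. v n \<noteq> 0}"
  have "kin v n = 0" if "n \<notin> ?S" for n
  proof -
    have "v (n + 1) = 0" using that by (metis (mono_tags) UnI2 add_diff_cancel_right' imageI mem_Collect_eq)
    then show ?thesis using that P_ge by (simp add: kin_def fdiff_def power_0_left)
  qed
  then have "kin v summable_on UNIV \<longleftrightarrow> kin v summable_on ?S"
    by (intro summable_on_cong_neutral) auto
  then show ?thesis using assms by (simp add: E_def)
qed

lemma finite_b_le: "finite {n. b n \<le> C}"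
proof -
  have "\<forall>\<^sub>F n in cofinite. C + 1 \<le> b n" using b_lim by (auto simp: filterlim_at_top)
  then have "finite {n. \<not> C + 1 \<le> b n}" by (simp add: eventually_cofinite)
  then show ?thesis by (rule rev_finite_subset) auto
qed

lemma M_nonempty: "M \<noteq> {}"
proof -
  define v :: "int \<Rightarrow> real" where "v n = (if n = 0 then 1 else if n = 1 then -1 else 0)" for n
  have "finite {n. v n \<noteq> 0}" by (rule finite_subset[of _ "{0,1}"]) (auto simp: v_def)
  then have "v \<in> E" by (rule finite_support_in_E)
  moreover have "pos_part v 0 \<noteq> 0" "neg_part v 1 \<noteq> 0" by (auto simp: pos_part_def neg_part_def v_def)
  then have "pos_part v \<noteq> (\<lambda>_. 0)" "neg_part v \<noteq> (\<lambda>_. 0)" by metis+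
  ultimately show ?thesis using exists_comb_in_M by blast
qed

text \<open>Fatou's lemma gives only an inequality for \<open>K\<close>, so membership of
  \<open>v\<close> in \<open>M\<close> is not claimed. It is enough that \<open>v\<close> has both
  signs: it can then be rescaled into \<open>M\<close>, and on \<open>M\<close> the same rescaling
  of \<open>u k\<close> does not raise the energy.\<close>

lemma exists_minimizer:
  obtains w where "w \<in> M" "\<And>u. u \<in> M \<Longrightarrow> J w \<le> J u"
proof -
  define m where "m = Inf (J ` M)"
  have bdd: "bdd_below (J ` M)" using J_pos by (intro bdd_belowI[of _ 0]) (auto intro: less_imp_le)
  have m_le: "m \<le> J u" if "u \<in> M" for u unfolding m_def using bdd that by (intro cInf_lower) auto
  have "\<exists>u\<in>M. J u < m + 1 / real (Suc k)" for k
    using cInf_lessD[of "J ` M" "m + 1 / real (Suc k)"] M_nonempty unfolding m_def by auto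
  then obtain u where u: "\<And>k. u k \<in> M" "\<And>k. J (u k) < m + 1 / real (Suc k)" by metis
  have uE: "u k \<in> E" for k using u(1) by (simp add: M_def)
  define \<gamma> where "\<gamma> = 1 / real P - 1 / q"
  have \<gamma>: "0 < \<gamma>" using gap_pos by (simp add: \<gamma>_def)
  \<comment> \<open>Along the sequence \<open>J\<close> is at most \<open>m + 1\<close>; dividing by
    the coefficient of \<open>K\<close> in \<open>K_le_J\<close> bounds the kinetic energy
    uniformly.\<close>
  define \<Gamma> where "\<Gamma> = (m + 1) / \<gamma>"
  have K\<Gamma>: "K (u k) \<le> \<Gamma>" for k
  proof -
    have "1 / real (Suc k) \<le> 1" by simp
    then have "\<gamma> * K (u k) \<le> m + 1" using K_le_J[OF u(1), of k] u(2)[of k] unfolding \<gamma>_def by linarith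
    then show ?thesis using \<gamma> by (simp add: \<Gamma>_def field_simps)
  qed
  define Mb where "Mb = 1 + \<Gamma> / b0"
  have ub: "\<bar>u k n\<bar> \<le> Mb" for k n
  proof -
    have "K (u k) / b0 \<le> \<Gamma> / b0" using K\<Gamma>[of k] b0_pos by (intro divide_right_mono) auto
    then show ?thesis using abs_le_of_K[OF uE[of k], of n] by (simp add: Mb_def)
  qed
  obtain \<rho> v where \<rho>: "strict_mono (\<rho> :: nat \<Rightarrow> nat)" and lim: "\<And>n. (\<lambda>k. u (\<rho> k) n) \<longlonglongrightarrow> v n"
    using pointwise_bounded_subsequence[of u Mb] ub by metis
  define C where "C k = m + 1 / real (Suc k)" for k
  have C: "C \<longlonglongrightarrow> m"
    using tendsto_add[OF tendsto_const[of m] LIMSEQ_Suc[OF lim_1_over_n]] unfolding C_def by simp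
  have JC: "J (u (\<rho> k)) \<le> C k" for k
  proof -
    have "1 / real (Suc (\<rho> k)) \<le> 1 / real (Suc k)"
      using seq_suble[OF \<rho>, of k] by (intro divide_left_mono) auto
    then show ?thesis using u(2)[of "\<rho> k"] by (simp add: C_def)
  qed
  have vE: "v \<in> E" by (rule limit_in_E[OF uE ub lim JC C])
  \<comment> \<open>Where the value exceeds 1 in modulus,
    \<open>b n \<le> b n * u n ^ P \<le> K u \<le> \<Gamma>\<close>. As \<open>b\<close> tends to
    infinity, only finitely many sites qualify, the same for all \<open>k\<close>.\<close>
  have site: "\<exists>n\<in>{n. b n \<le> \<Gamma>}. 1 < e * u (\<rho> k) n" if "e = 1 \<or> e = -1" for k e
  proof -
    obtain n where n: "1 < e * u (\<rho> k) n"
    proof (cases "e = 1")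
      case True
      then show thesis using M_exceeds_1(1)[OF u(1), of "\<rho> k"] that by auto
    next
      case False
      then have "e = -1" using \<open>e = 1 \<or> e = -1\<close> by simp
      moreover obtain n where "u (\<rho> k) n < -1" using M_exceeds_1(2)[OF u(1), of "\<rho> k"] by blast
      ultimately show thesis by (intro that[of n]) simp
    qed
    then have "1 < \<bar>u (\<rho> k) n\<bar>" using that by auto
    then have "1 \<le> \<bar>u (\<rho> k) n\<bar> ^ P" by simp
    then have "1 \<le> u (\<rho> k) n ^ P" using P_even by (simp add: power_even_abs)
    then have "b n * 1 \<le> b n * u (\<rho> k) n ^ P" using b_pos[of n] by (intro mult_left_mono) auto
    then have "b n \<le> \<Gamma>" using b_pow_le_kin[of n "u (\<rho> k)"] kin_le_K[OF uE, of "\<rho> k" n] K\<Gamma>[of "\<rho> k"] by linarith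
    with n show ?thesis by blast
  qed
  have "\<exists>n. 1 \<le> 1 * v n" by (rule pointwise_limit_exceeds_1[OF lim finite_b_le site]) simp
  then obtain n1 where "1 \<le> v n1" by auto
  then have "pos_part v n1 \<noteq> 0" by (simp add: pos_part_def)
  have "\<exists>n. 1 \<le> -1 * v n" by (rule pointwise_limit_exceeds_1[OF lim finite_b_le site]) simp
  then obtain n2 where "1 \<le> -1 * v n2" by blast
  then have "neg_part v n2 \<noteq> 0" by (simp add: neg_part_def)
  then have "pos_part v \<noteq> (\<lambda>_. 0)" "neg_part v \<noteq> (\<lambda>_. 0)"
    using \<open>pos_part v n1 \<noteq> 0\<close> by auto
  then obtain s t where st: "0 < s" "0 < t" "comb s t v \<in> M" using exists_comb_in_M[OF vE] by blast
  have "J (comb s t v) \<le> m"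
  proof (rule J_lower_semicontinuous)
    show "comb s t (u (\<rho> k)) \<in> E" for k by (rule comb_in_E[OF uE])
    show "\<bar>comb s t (u (\<rho> k)) n\<bar> \<le> (s + t) * Mb" for k n
    proof -
      have "\<bar>pos_part (u (\<rho> k)) n\<bar> \<le> Mb" "\<bar>neg_part (u (\<rho> k)) n\<bar> \<le> Mb"
        using ub[of "\<rho> k" n] by (auto simp: pos_part_def neg_part_def)
      then have "s * \<bar>pos_part (u (\<rho> k)) n\<bar> \<le> s * Mb" "t * \<bar>neg_part (u (\<rho> k)) n\<bar> \<le> t * Mb"
        using st by (auto intro: mult_left_mono)
      then have "s * \<bar>pos_part (u (\<rho> k)) n\<bar> + t * \<bar>neg_part (u (\<rho> k)) n\<bar> \<le> (s + t) * Mb"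
        by (simp add: distrib_right)
      moreover have "\<bar>comb s t (u (\<rho> k)) n\<bar> \<le> s * \<bar>pos_part (u (\<rho> k)) n\<bar> + t * \<bar>neg_part (u (\<rho> k)) n\<bar>"
        unfolding comb_def using st by (intro order_trans[OF abs_triangle_ineq]) (simp add: abs_mult)
      ultimately show ?thesis by linarith
    qed
    show "(\<lambda>k. comb s t (u (\<rho> k)) n) \<longlonglongrightarrow> comb s t v n" for n
      unfolding comb_def pos_part_def neg_part_def by (intro tendsto_intros lim)
    show "J (comb s t (u (\<rho> k))) \<le> C k" for k
      using J_comb_le[OF u(1), of s t "\<rho> k"] st JC[of k] by auto
  qed (rule C)
  then show thesis using st(3) m_le that by (meson order_trans)
qed

subsection \<open>The minimizer is a critical point\<close>

lemma Hlog_minus: "Hlog (- x) = Hlog x" and psi_minus: "psi (- x) = - psi x"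
  by (simp_all add: Hlog_def eta_def psi_def)

lemma Hlog_deriv_pos:
  assumes "0 < x"
  shows "(Hlog has_real_derivative - psi x) (at x)"
proof -
  have eq: "r / q\<^sup>2 * y powr q - r / q * (y powr q * ln y) = Hlog y" if "y \<in> {0<..}" for y
    using that by (simp add: Hlog_def eta_def ln_powr)
  have xq: "x powr q / x = x powr (q - 1)" "x powr (q - 1) = x powr (q - 2) * x"
    using assms powr_add[of x "q - 2" 1] by (simp_all add: powr_diff)
  have "((\<lambda>y. C * y powr q - D * (y powr q * ln y)) has_real_derivative
      C * (q * x powr (q - 1)) - D * (q * x powr (q - 1) * ln x + x powr q / x)) (at x)" for C D
    using assms by (auto intro!: derivative_eq_intros)
  from this[of "r / q\<^sup>2" "r / q"]
  have "((\<lambda>y. r / q\<^sup>2 * y powr q - r / q * (y powr q * ln y)) has_real_derivative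
      r / q\<^sup>2 * (q * x powr (q - 1)) - r / q * (q * x powr (q - 1) * ln x + x powr q / x)) (at x)" .
  moreover have "r / q\<^sup>2 * (q * x powr (q - 1)) - r / q * (q * x powr (q - 1) * ln x + x powr q / x) = - psi x"
    unfolding xq using assms q_gt2 by (simp add: psi_def ln_powr field_simps power2_eq_square)
  ultimately show ?thesis
    using has_field_derivative_transform_within_open[of "\<lambda>y. r / q\<^sup>2 * y powr q - r / q * (y powr q * ln y)" "- psi x" x "{0<..}" Hlog]
      assms eq by simp
qed

text \<open>Negative arguments follow from evenness. At 0, \<open>Hlog y = y * G y\<close> with
  \<open>G\<close> continuous and \<open>G 0 = 0\<close>, which is differentiability in
  Caratheodory's form.\<close>

lemma Hlog_deriv: "(Hlog has_real_derivative - psi x) (at x)"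
proof -
  consider "0 < x" | "x < 0" | "x = 0" by linarith
  then show ?thesis
  proof cases
    case 1
    then show ?thesis by (rule Hlog_deriv_pos)
  next
    case 2
    then have "(Hlog has_real_derivative - psi (- x)) (at (- x))" by (intro Hlog_deriv_pos) simp
    then have "((\<lambda>y. Hlog (- y)) has_real_derivative - (- psi (- x))) (at x)"
      by (simp only: DERIV_mirror[symmetric])
    then show ?thesis by (simp add: Hlog_minus psi_minus)
  next
    case 3
    define G where "G y = r / q\<^sup>2 * (\<bar>y\<bar> powr (q - 2) * y) - r * (y * abs_powr_ln (q - 2) y) / q" for y
    have "\<bar>y\<bar> powr q = \<bar>y\<bar> powr (q - 2) * y * y" for y
    proof (cases "y = 0")
      case False
      have "\<bar>y\<bar> powr q = \<bar>y\<bar> powr (q - 2) * \<bar>y\<bar> powr 2" unfolding powr_add[symmetric] by simp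
      also have "\<bar>y\<bar> powr 2 = y * y" using False by (simp add: power2_eq_square)
      finally show ?thesis by simp
    qed simp
    then have "Hlog y = y * G y" for y
      unfolding Hlog_def G_def eta_eq by (simp add: algebra_simps)
    moreover have "isCont G 0"
      unfolding G_def using q_gt2 by (intro continuous_intros isCont_abs_powr isCont_abs_powr_ln) auto
    moreover have "G 0 = 0" by (simp add: G_def)
    ultimately have "(Hlog has_real_derivative 0) (at 0)"
      unfolding CARAT_DERIV by (intro exI[of _ G]) (auto simp: mult.commute)
    then show ?thesis using 3 by simp
  qed
qed

text \<open>Exactly the terms of \<open>J (u(k := y))\<close> that contain \<open>y\<close>: the two
  edges at \<open>k\<close> and the site itself. The old value \<open>u k\<close> does not
  occur.\<close>

definition site_fun :: "(int \<Rightarrow> real) \<Rightarrow> int \<Rightarrow> real \<Rightarrow> real" where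
  "site_fun u k y = (a (k - 1) * (y - u (k - 1)) ^ P + a k * (u (k + 1) - y) ^ P + b k * y ^ P) / real P + c k * Hlog y"

definition site_deriv :: "(int \<Rightarrow> real) \<Rightarrow> int \<Rightarrow> real \<Rightarrow> real" where
  "site_deriv u k y = a (k - 1) * (y - u (k - 1)) ^ (P - 1) - a k * (u (k + 1) - y) ^ (P - 1) + b k * y ^ (P - 1) - c k * psi y"

lemma site_fun_deriv: "(site_fun u k has_real_derivative site_deriv u k y) (at y)"
proof -
  have p: "real P \<noteq> 0" using P_ge by simp
  have d1: "((\<lambda>y. (y - x) ^ P) has_real_derivative real P * (y - x) ^ (P - 1)) (at y)" for x
    by (auto intro!: derivative_eq_intros)
  have d2: "((\<lambda>y. (x - y) ^ P) has_real_derivative - (real P * (x - y) ^ (P - 1))) (at y)" for x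
    by (auto intro!: derivative_eq_intros)
  have "((\<lambda>y. (a (k - 1) * (y - u (k - 1)) ^ P + a k * (u (k + 1) - y) ^ P + b k * (y - 0) ^ P) / real P + c k * Hlog y)
      has_real_derivative (a (k - 1) * (real P * (y - u (k - 1)) ^ (P - 1)) + a k * (- (real P * (u (k + 1) - y) ^ (P - 1)))
      + b k * (real P * (y - 0) ^ (P - 1))) / real P + c k * (- psi y)) (at y)"
    by (intro DERIV_add DERIV_cdivide DERIV_cmult d1 d2 Hlog_deriv)
  moreover have "(a (k - 1) * (real P * (y - u (k - 1)) ^ (P - 1)) + a k * (- (real P * (u (k + 1) - y) ^ (P - 1)))
      + b k * (real P * (y - 0) ^ (P - 1))) / real P + c k * (- psi y) = site_deriv u k y"
    using p by (simp add: site_deriv_def field_simps)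
  ultimately show ?thesis by (simp add: site_fun_def[abs_def])
qed

lemma J_eq_infsum:
  assumes "u \<in> E"
  shows "(\<lambda>n. kin u n / real P + c n * Hlog (u n)) summable_on UNIV"
    and "J u = (\<Sum>\<^sub>\<infinity>n. kin u n / real P + c n * Hlog (u n))"
proof -
  have e: "kin u n / real P + c n * Hlog (u n)
      = 1 / real P * kin u n + (r / q\<^sup>2 * (c n * \<bar>u n\<bar> powr q) + (- 1 / q) * (c n * eta (u n)))" for n
    by (simp add: Hlog_def algebra_simps)
  have s: "(\<lambda>n. 1 / real P * kin u n) summable_on UNIV" "(\<lambda>n. r / q\<^sup>2 * (c n * \<bar>u n\<bar> powr q)) summable_on UNIV"
    "(\<lambda>n. (- 1 / q) * (c n * eta (u n))) summable_on UNIV"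
    using assms E_eta_summable[OF assms] E_powr_summable[OF assms]
    by (auto simp only: E_def mem_Collect_eq intro!: summable_on_cmult_right)
  show "(\<lambda>n. kin u n / real P + c n * Hlog (u n)) summable_on UNIV"
    unfolding e by (intro summable_on_add s)
  have "(\<Sum>\<^sub>\<infinity>n. kin u n / real P + c n * Hlog (u n)) = 1 / real P * K u + (r / q\<^sup>2 * A u + (- 1 / q) * B u)"
    unfolding e infsum_add[OF s(1) summable_on_add[OF s(2,3)]] infsum_add[OF s(2,3)]
      infsum_cmult_right' K_def A_def B_def ..
  then show "J u = (\<Sum>\<^sub>\<infinity>n. kin u n / real P + c n * Hlog (u n))" by (simp add: J_def)
qed

lemma update_in_E:
  assumes "u \<in> E" shows "u(k := y) \<in> E"
proof -
  have "(\<lambda>n. kin (u(k := y)) n - kin u n) summable_on UNIV"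
    by (rule infsum_finite_support(1)[of "{k - 1, k}"]) (auto simp: kin_def fdiff_def)
  from summable_on_add[OF this, of "kin u"] show ?thesis using assms by (simp add: E_def)
qed

text \<open>Only the terms at \<open>k - 1\<close> and \<open>k\<close> change, so the difference of
  the two infinite sums is finite and the perturbation is a problem in one real variable.\<close>

lemma J_update:
  assumes "u \<in> E"
  shows "J (u(k := y)) - J u = site_fun u k y - site_fun u k (u k)"
proof -
  let ?j = "\<lambda>u n. kin u n / real P + c n * Hlog (u n)"
  let ?u = "u(k := y)"
  let ?d = "\<lambda>n. ?j ?u n - ?j u n"
  have d0: "?d n = 0" if "n \<notin> {k - 1, k}" for n using that by (simp add: kin_def fdiff_def)
  have fin: "finite {k - 1, k}" by simp
  have ds: "?d summable_on UNIV" "infsum ?d UNIV = ?d (k - 1) + ?d k"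
  proof -
    show "?d summable_on UNIV" by (rule infsum_finite_support(1)[OF fin d0])
    have "infsum ?d UNIV = sum ?d {k - 1, k}" by (rule infsum_finite_support(2)[OF fin d0])
    then show "infsum ?d UNIV = ?d (k - 1) + ?d k" by simp
  qed
  have "J ?u = (\<Sum>\<^sub>\<infinity>n. ?j u n + ?d n)" using J_eq_infsum(2)[OF update_in_E[OF assms]] by simp
  also have "\<dots> = J u + infsum ?d UNIV"
    unfolding infsum_add[OF J_eq_infsum(1)[OF assms] ds(1)] J_eq_infsum(2)[OF assms] ..
  finally have "J ?u - J u = ?d (k - 1) + ?d k" unfolding ds(2) by simp
  moreover have "?d (k - 1) = (a (k - 1) * (y - u (k - 1)) ^ P - a (k - 1) * (u k - u (k - 1)) ^ P) / real P"
    by (simp add: kin_def fdiff_def diff_divide_distrib add_divide_distrib)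
  moreover have "?d k = (a k * (u (k + 1) - y) ^ P + b k * y ^ P - a k * (u (k + 1) - u k) ^ P - b k * u k ^ P) / real P
      + c k * Hlog y - c k * Hlog (u k)"
    by (simp add: kin_def fdiff_def diff_divide_distrib add_divide_distrib)
  ultimately show ?thesis by (simp add: site_fun_def diff_divide_distrib add_divide_distrib)
qed

lemma dJ_site: "dJ u (\<lambda>n. of_bool (n = k)) = site_deriv u k (u k)"
proof -
  let ?e = "\<lambda>n. of_bool (n = k) :: real"
  have "dK u ?e = (\<Sum>n\<in>{k - 1, k}. dkin u ?e n)"
    unfolding dK_def by (rule infsum_finite_support(2)) (auto simp: dkin_def fdiff_def)
  moreover have "dB u ?e = (\<Sum>n\<in>{k}. c n * psi (u n) * ?e n)"
    unfolding dB_def by (rule infsum_finite_support(2)) auto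
  ultimately show ?thesis by (simp add: dJ_def site_deriv_def dkin_def fdiff_def)
qed

lemma site_fun_descent:
  assumes "0 < h" and neg: "\<And>\<tau>. 0 \<le> \<tau> \<Longrightarrow> \<tau> \<le> h \<Longrightarrow> e * site_deriv u k (y + e * \<tau>) < 0"
  shows "site_fun u k (y + e * h) < site_fun u k y"
proof -
  have "(\<lambda>\<tau>. site_fun u k (y + e * \<tau>)) h < (\<lambda>\<tau>. site_fun u k (y + e * \<tau>)) 0"
  proof (rule DERIV_neg_imp_decreasing[OF assms(1)])
    fix \<tau> assume \<tau>: "0 \<le> \<tau>" "\<tau> \<le> h"
    have "((\<lambda>\<tau>. y + e * \<tau>) has_real_derivative e) (at \<tau>)" by (auto intro!: derivative_eq_intros)
    from DERIV_chain2[OF site_fun_deriv this]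
    show "\<exists>d. ((\<lambda>\<tau>. site_fun u k (y + e * \<tau>)) has_real_derivative d) (at \<tau>) \<and> d < 0"
      using neg[OF \<tau>] by (auto simp: mult.commute)
  qed
  then show ?thesis by simp
qed

text \<open>Joint continuity is required because scaling also moves the neighbours of
  \<open>k\<close>, which enter the site derivative.\<close>

lemma isCont_site_deriv_comb:
  "isCont (\<lambda>z. site_deriv (comb (fst z) (fst (snd z)) w) k (comb (fst z) (fst (snd z)) w k + snd (snd z))) z"
proof -
  have "isCont (\<lambda>z::real \<times> real \<times> real. psi (comb (fst z) (fst (snd z)) w k + snd (snd z))) z"
    unfolding comb_def by (intro isCont_o2[OF _ isCont_psi] continuous_intros)
  then show ?thesis unfolding site_deriv_def comb_def by (intro continuous_intros)
qed

text \<open>If moving \<open>w k\<close> lowered the energy, it would do so uniformly for all rescalings near \<open>(1, 1)\<close>. On a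
  small square around \<open>(1, 1)\<close> the fibering map of the perturbed sequence would then have an interior
  maximum, hence a point of \<open>M\<close> of energy below the minimum.\<close>

lemma minimizer_site_deriv:
  assumes w: "w \<in> M" and min: "\<And>u. u \<in> M \<Longrightarrow> J w \<le> J u"
  shows "site_deriv w k (w k) = 0"
proof (rule ccontr)
  assume nz: "site_deriv w k (w k) \<noteq> 0"
  have wE: "w \<in> E" and wpn: "pos_part w \<noteq> (\<lambda>_. 0)" "neg_part w \<noteq> (\<lambda>_. 0)" using w by (auto simp: M_def)
  \<comment> \<open>The direction in which changing \<open>w k\<close> lowers the energy.\<close>
  define e where "e = - sgn (site_deriv w k (w k))"
  have e: "e = 1 \<or> e = -1" using nz by (auto simp: e_def sgn_if)
  have neg0: "e * site_deriv w k (w k) < 0" using nz by (auto simp: e_def sgn_if)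
  define D where "D = (\<lambda>z. e * site_deriv (comb (fst z) (fst (snd z)) w) k (comb (fst z) (fst (snd z)) w k + snd (snd z)))"
  have "isCont D (1, 1, 0)" unfolding D_def by (intro continuous_intros isCont_site_deriv_comb)
  then have "(D \<longlongrightarrow> D (1, 1, 0)) (nhds (1, 1, 0))" by (simp only: isCont_def tendsto_at_iff_tendsto_nhds)
  moreover have "D (1, 1, 0) < 0" using neg0 by (simp add: D_def)
  ultimately have "\<forall>\<^sub>F z in nhds (1, 1, 0). D z < 0" by (rule order_tendstoD(2))
  then obtain d where d: "0 < d" "\<And>z. dist z (1, 1, 0) < d \<Longrightarrow> D z < 0"
    by (auto simp: eventually_nhds_metric)
  have dist_le: "dist (s, t, h) (1, 1, 0) \<le> \<bar>s - 1\<bar> + \<bar>t - 1\<bar> + \<bar>h\<bar>" for s t h :: real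
  proof -
    have "dist (s, t, h) (1, 1, 0) \<le> dist s 1 + dist (t, h) (1, 0)"
      unfolding dist_Pair_Pair[of s] by (rule sqrt_sum_squares_le_sum) auto
    also have "dist (t, h) (1, 0) \<le> dist t 1 + dist h 0"
      unfolding dist_Pair_Pair by (rule sqrt_sum_squares_le_sum) auto
    finally show ?thesis by (simp add: dist_real_def)
  qed
  \<comment> \<open>The bounds on \<open>s\<close>, \<open>t\<close> and \<open>h\<close> below add
    up to \<open>4 * \<delta> \<le> d / 2\<close>. The cap \<open>1 / 2\<close> keeps the factors
    positive and at most 2, whence the range \<open>2 * \<delta>\<close> for
    \<open>h\<close>.\<close>
  define \<delta> where "\<delta> = min (1 / 2) (d / 8)"
  have \<delta>: "0 < \<delta>" "\<delta> \<le> 1 / 2" "8 * \<delta> \<le> d" using d by (auto simp: \<delta>_def)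
  have neg: "e * site_deriv (comb s t w) k (comb s t w k + h) < 0"
    if "\<bar>s - 1\<bar> \<le> \<delta>" "\<bar>t - 1\<bar> \<le> \<delta>" "\<bar>h\<bar> \<le> 2 * \<delta>" for s t h
  proof -
    have "dist (s, t, h) (1, 1, 0) < d" using dist_le[of s t h] that \<delta> by linarith
    from d(2)[OF this] show ?thesis by (simp add: D_def)
  qed
  \<comment> \<open>Decides which factor acts on the perturbed site. If \<open>w k = 0\<close>, the
    perturbation itself gives the site the sign \<open>e\<close>; otherwise
    \<open>\<epsilon>1 < \<bar>w k\<bar>\<close> preserves its sign.\<close>
  define pos where "pos \<longleftrightarrow> 0 < w k \<or> (w k = 0 \<and> e = 1)"
  define \<epsilon>1 where "\<epsilon>1 = (if w k = 0 then \<delta> else min \<delta> (\<bar>w k\<bar> / 2))"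
  have \<epsilon>1: "0 < \<epsilon>1" "\<epsilon>1 \<le> \<delta>" "w k \<noteq> 0 \<Longrightarrow> \<epsilon>1 < \<bar>w k\<bar>" using \<delta> by (auto simp: \<epsilon>1_def)
  define z where "z \<epsilon> = w(k := w k + e * \<epsilon>)" for \<epsilon>
  have zE: "z \<epsilon> \<in> E" for \<epsilon> unfolding z_def by (rule update_in_E[OF wE])
  have comb_z: "comb s t (z \<epsilon>) = (comb s t w)(k := comb s t w k + e * ((if pos then s else t) * \<epsilon>))"
    if "0 < \<epsilon>" "\<epsilon> \<le> \<epsilon>1" for s t \<epsilon>
    using e \<epsilon>1(3) that
    by (intro ext) (auto simp: comb_def z_def pos_part_def neg_part_def pos_def max_def min_def algebra_simps)
  have z_pn: "pos_part (z \<epsilon>) \<noteq> (\<lambda>_. 0)" "neg_part (z \<epsilon>) \<noteq> (\<lambda>_. 0)" if \<epsilon>: "0 < \<epsilon>" "\<epsilon> \<le> \<epsilon>1" for \<epsilon>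
  proof -
    obtain i where i: "0 < w i" using wpn(1) unfolding pos_part_nonzero_iff by blast
    obtain j where j: "w j < 0" using wpn(2) unfolding neg_part_nonzero_iff by blast
    have "0 < z \<epsilon> i" using i e \<epsilon>1(3) \<epsilon> by (auto simp: z_def)
    moreover have "z \<epsilon> j < 0" using j e \<epsilon>1(3) \<epsilon> by (auto simp: z_def)
    ultimately show "pos_part (z \<epsilon>) \<noteq> (\<lambda>_. 0)" "neg_part (z \<epsilon>) \<noteq> (\<lambda>_. 0)"
      unfolding pos_part_nonzero_iff neg_part_nonzero_iff by blast+
  qed
  have less: "J (comb s t (z \<epsilon>)) < J (comb s t w)"
    if \<epsilon>: "0 < \<epsilon>" "\<epsilon> \<le> \<epsilon>1" and st: "\<bar>s - 1\<bar> \<le> \<delta>" "\<bar>t - 1\<bar> \<le> \<delta>" for s t \<epsilon>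
  proof -
    define \<sigma> where "\<sigma> = (if pos then s else t)"
    have \<sigma>: "0 < \<sigma>" "\<sigma> \<le> 2" using st \<delta> by (auto simp: \<sigma>_def)
    have "\<sigma> * \<epsilon> \<le> 2 * \<delta>" using \<sigma> \<epsilon> \<epsilon>1(2) by (intro mult_mono) auto
    then have "site_fun (comb s t w) k (comb s t w k + e * (\<sigma> * \<epsilon>)) < site_fun (comb s t w) k (comb s t w k)"
      using \<sigma> \<epsilon> e st by (intro site_fun_descent neg) auto
    then show ?thesis
      using J_update[OF comb_in_E[OF wE], of s t k "comb s t w k + e * (\<sigma> * \<epsilon>)"]
      unfolding comb_z[OF \<epsilon>] \<sigma>_def[symmetric] by simp
  qed
  let ?R = "{1 - \<delta>..1 + \<delta>} \<times> {1 - \<delta>..1 + \<delta>}"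
  \<comment> \<open>The boundary of the square. It avoids \<open>(1, 1)\<close>, so by strictness
    the fibering map of \<open>w\<close> stays below \<open>J w\<close> there, with maximum
    \<open>m'\<close> by compactness.\<close>
  let ?S = "?R - {1 - \<delta><..<1 + \<delta>} \<times> {1 - \<delta><..<1 + \<delta>}"
  have cR: "compact ?R" by (intro compact_Times) auto
  have cS: "compact ?S" by (intro compact_diff cR open_Times) auto
  have "(1 + \<delta>, 1) \<in> ?S" using \<delta> by auto
  then have S_ne: "?S \<noteq> {}" by blast
  have R_sub: "?R \<subseteq> {0..} \<times> {0..}" using \<delta> by auto
  have cont: "continuous_on ?R (\<lambda>x. J (comb (fst x) (snd x) u))" if "u \<in> E" for u
    by (rule continuous_on_subset[OF continuous_J_comb[OF that] R_sub])
  have "continuous_on ?S (\<lambda>x. J (comb (fst x) (snd x) w))"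
    by (rule continuous_on_subset[OF cont[OF wE]]) auto
  from continuous_attains_sup[OF cS S_ne this] obtain x where x: "x \<in> ?S"
    "\<And>y. y \<in> ?S \<Longrightarrow> J (comb (fst y) (snd y) w) \<le> J (comb (fst x) (snd x) w)" by blast
  define m' where "m' = J (comb (fst x) (snd x) w)"
  have m': "m' < J w" unfolding m'_def
  proof (rule J_comb_less[OF w])
    show "0 \<le> fst x" "0 \<le> snd x" using x(1) R_sub by auto
    show "fst x \<noteq> 1 \<or> snd x \<noteq> 1" using x(1) \<delta> by (cases x) auto
  qed
  have "isCont (\<lambda>\<epsilon>. site_fun w k (w k + e * \<epsilon>)) 0"
    by (intro isCont_o2[OF _ DERIV_isCont[OF site_fun_deriv]] continuous_intros)
  then have "isCont (\<lambda>\<epsilon>. J w + (site_fun w k (w k + e * \<epsilon>) - site_fun w k (w k))) 0"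
    by (intro continuous_intros)
  moreover have "J (z \<epsilon>) = J w + (site_fun w k (w k + e * \<epsilon>) - site_fun w k (w k))" for \<epsilon>
    using J_update[OF wE, of k "w k + e * \<epsilon>"] by (simp add: z_def)
  ultimately have "isCont (\<lambda>\<epsilon>. J (z \<epsilon>)) 0" by simp
  moreover have "z 0 = w" by (simp add: z_def)
  ultimately have "((\<lambda>\<epsilon>. J (z \<epsilon>)) \<longlongrightarrow> J w) (at_right 0)"
    unfolding isCont_def by (auto intro: tendsto_within_subset)
  \<comment> \<open>Choose the perturbation so small that its energy at \<open>(1, 1)\<close> still
    exceeds \<open>m'\<close>. On the boundary its energy is below that of \<open>w\<close>, hence
    below \<open>m'\<close>, so its maximum over the square is interior.\<close>
  then have ev: "\<forall>\<^sub>F \<epsilon> in at_right 0. m' < J (z \<epsilon>)" using m' by (rule order_tendstoD(1))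
  have "\<forall>\<^sub>F \<epsilon> in at_right 0. \<epsilon> \<in> {0<..<\<epsilon>1}" by (rule eventually_at_right_real[OF \<epsilon>1(1)])
  from eventually_happens'[OF _ eventually_conj[OF ev this]]
  obtain \<epsilon> where \<epsilon>: "m' < J (z \<epsilon>)" "0 < \<epsilon>" "\<epsilon> \<le> \<epsilon>1" by auto
  have R_ne: "?R \<noteq> {}" using S_ne by blast
  from continuous_attains_sup[OF cR R_ne cont[OF zE]] obtain y where y: "y \<in> ?R"
    "\<And>x. x \<in> ?R \<Longrightarrow> J (comb (fst x) (snd x) (z \<epsilon>)) \<le> J (comb (fst y) (snd y) (z \<epsilon>))" by blast
  obtain s0 t0 where y0: "y = (s0, t0)" by (cases y)
  have st0: "\<bar>s0 - 1\<bar> \<le> \<delta>" "\<bar>t0 - 1\<bar> \<le> \<delta>" using y(1) by (auto simp: y0 abs_le_iff)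
  have max: "J (comb s t (z \<epsilon>)) \<le> J (comb s0 t0 (z \<epsilon>))" if "\<bar>s - 1\<bar> \<le> \<delta>" "\<bar>t - 1\<bar> \<le> \<delta>" for s t
    using y(2)[of "(s, t)"] that by (auto simp: y0 abs_le_iff)
  have big: "m' < J (comb s0 t0 (z \<epsilon>))" using max[of 1 1] \<delta> \<epsilon>(1) by simp
  have lt: "J (comb s0 t0 (z \<epsilon>)) < J (comb s0 t0 w)" by (rule less[OF \<epsilon>(2,3) st0])
  have "(s0, t0) \<notin> ?S"
  proof
    assume "(s0, t0) \<in> ?S"
    from x(2)[OF this] have "J (comb s0 t0 w) \<le> m'" by (simp add: m'_def)
    then show False using big lt by linarith
  qed
  then have int: "\<bar>s0 - 1\<bar> < \<delta>" "\<bar>t0 - 1\<bar> < \<delta>" using y(1) by (auto simp: y0 abs_less_iff)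
  have s0t0: "0 < s0" "0 < t0" using int \<delta> by linarith+
  define \<eta> where "\<eta> = min (\<delta> - \<bar>s0 - 1\<bar>) (\<delta> - \<bar>t0 - 1\<bar>)"
  have "0 < \<eta>" using int by (simp add: \<eta>_def)
  have "comb s0 t0 (z \<epsilon>) \<in> M"
  proof (rule comb_in_M[OF zE z_pn[OF \<epsilon>(2,3)] s0t0 \<open>0 < \<eta>\<close>])
    fix s t assume "\<bar>s - s0\<bar> < \<eta>" "\<bar>t - t0\<bar> < \<eta>"
    then show "J (comb s t (z \<epsilon>)) \<le> J (comb s0 t0 (z \<epsilon>))" by (intro max) (auto simp: \<eta>_def)
  qed
  \<comment> \<open>The cycle is \<open>J w \<le> J (comb s0 t0 (z \<epsilon>)) < J (comb s0 t0 w)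
    \<le> J w\<close>.\<close>
  from min[OF this] lt J_comb_le[OF w, of s0 t0] s0t0 show False by simp
qed

section \<open>From single sites to all directions in \<open>E\<close>\<close>

lemma dJ_finite_support:
  assumes fin: "finite {n. v n \<noteq> 0}" and crit: "\<And>k. dJ w (\<lambda>n. of_bool (n = k)) = 0"
  shows "dJ w v = 0"
proof -
  let ?S = "{n. v n \<noteq> 0}"
  let ?e = "\<lambda>k n. of_bool (n = k) :: real"
  have v: "v = (\<lambda>n. \<Sum>k\<in>?S. v k * ?e k n)"
  proof
    fix n
    have "(\<Sum>k\<in>?S. v k * ?e k n) = (\<Sum>k\<in>?S. if k = n then v k else 0)"
      by (intro sum.cong) auto
    also have "\<dots> = v n" using fin by (auto simp: sum.delta)
    finally show "v n = (\<Sum>k\<in>?S. v k * ?e k n)" ..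
  qed
  have s1: "dkin w (?e k) summable_on UNIV" for k
    by (rule infsum_finite_support(1)[of "{k - 1, k}"]) (auto simp: dkin_def fdiff_def)
  have s2: "(\<lambda>n. c n * psi (w n) * ?e k n) summable_on UNIV" for k
    by (rule infsum_finite_support(1)[of "{k}"]) auto
  have "dkin w v n = (\<Sum>k\<in>?S. v k * dkin w (?e k) n)" for n
    by (subst v) (rule dkin_sum)
  then have "dK w v = (\<Sum>\<^sub>\<infinity>n. \<Sum>k\<in>?S. v k * dkin w (?e k) n)"
    unfolding dK_def by (rule infsum_cong)
  also have "\<dots> = (\<Sum>k\<in>?S. v k * dK w (?e k))"
    using infsum_sum_finite[OF fin summable_on_cmult_right[OF s1]]
    by (simp add: dK_def infsum_cmult_right')
  finally have K: "dK w v = (\<Sum>k\<in>?S. v k * dK w (?e k))" .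
  have "c n * psi (w n) * v n = (\<Sum>k\<in>?S. v k * (c n * psi (w n) * ?e k n))" for n
    by (subst v) (simp only: sum_distrib_left mult_ac)
  then have "dB w v = (\<Sum>\<^sub>\<infinity>n. \<Sum>k\<in>?S. v k * (c n * psi (w n) * ?e k n))"
    unfolding dB_def by simp
  also have "\<dots> = (\<Sum>k\<in>?S. v k * dB w (?e k))"
    using infsum_sum_finite[OF fin summable_on_cmult_right[OF s2]]
    by (simp add: dB_def infsum_cmult_right')
  finally have "dJ w v = (\<Sum>k\<in>?S. v k * dJ w (?e k))"
    using K by (simp add: dJ_def right_diff_distrib sum_subtractf)
  then show ?thesis by (simp add: crit)
qed

text \<open>A site that survives thresholding has \<open>\<bar>v n\<bar> \<ge> \<epsilon>\<close>,
  hence \<open>b n \<le> K v / \<epsilon> ^ P\<close>, and \<open>b\<close> tends to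
  infinity.\<close>

lemma finite_soft_support:
  assumes "v \<in> E" "0 < \<epsilon>"
  shows "finite {n. soft \<epsilon> (v n) \<noteq> 0}"
proof (rule finite_subset[OF _ finite_b_le])
  show "{n. soft \<epsilon> (v n) \<noteq> 0} \<subseteq> {n. b n \<le> K v / \<epsilon> ^ P}"
  proof safe
    fix n assume "soft \<epsilon> (v n) \<noteq> 0"
    then have "\<epsilon> \<le> \<bar>v n\<bar>" using soft_eq_0[of "v n" \<epsilon>] by linarith
    then have "\<epsilon> ^ P \<le> \<bar>v n\<bar> ^ P" using assms by (intro power_mono) auto
    then have "\<epsilon> ^ P \<le> v n ^ P" using P_even by (simp add: power_even_abs)
    then have "b n * \<epsilon> ^ P \<le> b n * v n ^ P" using b_pos[of n] by (intro mult_left_mono) auto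
    then have "b n * \<epsilon> ^ P \<le> K v" using b_pow_le_kin[of n v] kin_le_K[OF assms(1), of n] by linarith
    then show "b n \<le> K v / \<epsilon> ^ P" using assms by (simp add: field_simps)
  qed
qed

lemma critical_of_sites:
  assumes wE: "w \<in> E" and crit: "\<And>k. dJ w (\<lambda>n. of_bool (n = k)) = 0" and vE: "v \<in> E"
  shows "dJ w v = 0"
proof -
  define \<epsilon> where "\<epsilon> j = 1 / real (Suc j)" for j
  have \<epsilon>: "0 < \<epsilon> j" for j by (simp add: \<epsilon>_def)
  have \<epsilon>0: "\<epsilon> \<longlonglongrightarrow> 0" unfolding \<epsilon>_def by (rule LIMSEQ_Suc[OF lim_1_over_n])
  define vj where "vj j n = soft (\<epsilon> j) (v n)" for j n
  have lim: "(\<lambda>j. vj j n) \<longlonglongrightarrow> v n" for n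
  proof (rule LIM_zero_cancel, rule Lim_null_comparison[OF _ \<epsilon>0])
    show "\<forall>\<^sub>F j in sequentially. norm (vj j n - v n) \<le> \<epsilon> j"
      using soft_close \<epsilon> by (auto simp: vj_def less_imp_le)
  qed
  have le: "\<bar>vj j n\<bar> \<le> \<bar>v n\<bar>" "\<bar>fdiff (vj j) n\<bar> \<le> \<bar>fdiff v n\<bar>" for j n
    using soft_abs_le soft_lipschitz \<epsilon>[of j] by (auto simp: vj_def fdiff_def less_imp_le)
  have young: "\<bar>x ^ (P - 1) * y'\<bar> \<le> x ^ P + y ^ P" if "\<bar>y'\<bar> \<le> \<bar>y\<bar>" for x y y' :: real
  proof -
    have "\<bar>x ^ (P - 1) * y'\<bar> \<le> \<bar>x ^ (P - 1) * y\<bar>" unfolding abs_mult using that by (intro mult_left_mono) auto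
    then show ?thesis using abs_power_mult_le[OF P_even P_ge1, of x y] by linarith
  qed
  have "(\<lambda>j. infsum (dkin w (vj j)) UNIV) \<longlonglongrightarrow> infsum (dkin w v) UNIV"
  proof (rule tendsto_infsum_dominated(2))
    show "(\<lambda>j. dkin w (vj j) n) \<longlonglongrightarrow> dkin w v n" for n
      unfolding dkin_def fdiff_def by (intro tendsto_intros lim)
    show "(\<lambda>n. kin w n + kin v n) summable_on UNIV"
      using wE vE by (intro summable_on_add) (auto simp: E_def)
    show "\<bar>dkin w (vj j) n\<bar> \<le> kin w n + kin v n" for j n
    proof -
      have "\<bar>a n * (fdiff w n ^ (P - 1) * fdiff (vj j) n)\<bar> \<le> a n * (fdiff w n ^ P + fdiff v n ^ P)"
        "\<bar>b n * (w n ^ (P - 1) * vj j n)\<bar> \<le> b n * (w n ^ P + v n ^ P)"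
        unfolding abs_mult[of "a n"] abs_mult[of "b n"] using a_pos[of n] b_pos[of n]
        by (simp_all only: abs_of_pos) (intro mult_left_mono young le less_imp_le; assumption)+
      then have "\<bar>a n * (fdiff w n ^ (P - 1) * fdiff (vj j) n) + b n * (w n ^ (P - 1) * vj j n)\<bar>
          \<le> a n * (fdiff w n ^ P + fdiff v n ^ P) + b n * (w n ^ P + v n ^ P)" by linarith
      then show ?thesis by (simp add: dkin_def kin_def algebra_simps)
    qed
  qed
  moreover obtain C where C: "0 \<le> C" "\<And>x. \<bar>x\<bar> \<le> 1 + K w / b0 \<Longrightarrow> \<bar>psi x\<bar> \<le> C"
    using bounded_on_interval[of psi "1 + K w / b0"] isCont_psi by auto
  have "(\<lambda>j. \<Sum>\<^sub>\<infinity>n. c n * psi (w n) * vj j n) \<longlonglongrightarrow> (\<Sum>\<^sub>\<infinity>n. c n * psi (w n) * v n)"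
  proof (rule tendsto_infsum_dominated(2))
    show "(\<lambda>j. c n * psi (w n) * vj j n) \<longlonglongrightarrow> c n * psi (w n) * v n" for n
      by (intro tendsto_intros lim)
    show "(\<lambda>n. c n * (C * (1 + K v / b0))) summable_on UNIV" by (intro summable_on_cmult_left c_summable)
    show "\<bar>c n * psi (w n) * vj j n\<bar> \<le> c n * (C * (1 + K v / b0))" for j n
    proof -
      have "\<bar>psi (w n)\<bar> * \<bar>vj j n\<bar> \<le> C * (1 + K v / b0)"
        using C abs_le_of_K[OF wE] order_trans[OF le(1) abs_le_of_K[OF vE]] by (intro mult_mono) auto
      then show ?thesis using c_pos[of n] by (simp add: abs_mult mult.assoc)
    qed
  qed
  ultimately have "(\<lambda>j. dJ w (vj j)) \<longlonglongrightarrow> dJ w v"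
    unfolding dJ_def dK_def dB_def by (intro tendsto_diff)
  moreover have "dJ w (vj j) = 0" for j
    using finite_soft_support[OF vE \<epsilon>] by (intro dJ_finite_support[OF _ crit]) (simp add: vj_def)
  ultimately have "(\<lambda>j::nat. 0) \<longlonglongrightarrow> dJ w v" by simp
  from LIMSEQ_unique[OF this tendsto_const] show ?thesis .
qed

text \<open>Of three nodal pieces the last one can be dropped (scaled by 0): the rescaling inequality is then
  strict, although the first two pieces can still be rescaled into \<open>M\<close>.\<close>

lemma minimizer_no_triple:
  assumes w: "w \<in> M" and min: "\<And>u. u \<in> M \<Longrightarrow> J w \<le> J u"
    and crit: "\<And>v. v \<in> E \<Longrightarrow> dJ w v = 0"
    and e: "e = 1 \<or> e = -1" and n: "n1 < n2" "n2 < n3" "0 < e * w n1" "e * w n2 < 0" "0 < e * w n3"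
  shows False
proof -
  have wE: "w \<in> E" using w by (simp add: M_def)
  \<comment> \<open>The sites with the sign \<open>e\<close> are split at \<open>n2\<close>; all
    others, \<open>n2\<close> included, form one piece. Labels \<open>Some True\<close> and
    \<open>Some False\<close> could meet only on the edge from \<open>n2\<close>, and
    \<open>n2\<close> carries neither.\<close>
  define \<kappa> where "\<kappa> n = (if 0 < e * w n then Some (n \<le> n2) else None)" for n
  have nod: "nodal \<kappa> w"
    unfolding nodal_def
  proof
    fix n show "\<kappa> n = \<kappa> (n + 1) \<or> w n * w (n + 1) \<le> 0"
    proof (rule ccontr)
      assume a: "\<not> ?thesis"
      then have "0 < w n * w (n + 1)" "\<kappa> n \<noteq> \<kappa> (n + 1)" by auto
      then have "0 < e * w n \<longleftrightarrow> 0 < e * w (n + 1)" using e by (auto simp: zero_less_mult_iff)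
      then have "0 < e * w n" "(n \<le> n2) \<noteq> (n + 1 \<le> n2)"
        using \<open>\<kappa> n \<noteq> \<kappa> (n + 1)\<close> by (auto simp: \<kappa>_def split: if_splits)
      then have "n = n2" by auto
      then show False using \<open>0 < e * w n\<close> n(4) by simp
    qed
  qed
  let ?cut = "\<lambda>i. if i = Some False then 0 else 1 :: real"
  define u where "u = rescale \<kappa> ?cut w"
  have uE: "u \<in> E" unfolding u_def by (rule rescale_in_E[OF wE nod])
  have "u n1 = w n1" "u n2 = w n2" using n by (auto simp: u_def rescale_def \<kappa>_def)
  then have "(0 < u n1 \<and> u n2 < 0) \<or> (0 < u n2 \<and> u n1 < 0)" using n e by auto
  then have "pos_part u \<noteq> (\<lambda>_. 0)" "neg_part u \<noteq> (\<lambda>_. 0)"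
    unfolding pos_part_nonzero_iff neg_part_nonzero_iff by blast+
  from exists_comb_in_M[OF uE this] obtain s t where st: "0 < s" "0 < t" "comb s t u \<in> M" .
  \<comment> \<open>If \<open>e = 1\<close>, the kept piece \<open>Some True\<close> is the positive
    part of \<open>u\<close> and takes \<open>s\<close>, while \<open>None\<close> takes
    \<open>t\<close>; if \<open>e = -1\<close>, the roles are exchanged. The factor 0 on the dropped
    piece makes the rescaling strict.\<close>
  define \<sigma> where "\<sigma> i = (if i = Some False then 0 else if (i = Some True) = (e = 1) then s else t)" for i
  have "comb s t u = rescale \<kappa> \<sigma> w"
  proof
    fix n show "comb s t u n = rescale \<kappa> \<sigma> w n"
      using e by (auto simp: comb_def u_def rescale_def \<kappa>_def \<sigma>_def pos_part_def neg_part_def)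
  qed
  moreover have "J (rescale \<kappa> \<sigma> w) < J w"
  proof (rule J_rescale_less[OF wE nod])
    show "dJ w (piece \<kappa> w i) = 0" for i by (rule crit[OF piece_in_E[OF wE nod]])
    show "0 \<le> \<sigma> i" for i using st by (simp add: \<sigma>_def)
    show "\<sigma> (Some False) \<noteq> 1" by (simp add: \<sigma>_def)
    have "piece \<kappa> w (Some False) n3 \<noteq> 0" using n e by (auto simp: piece_def \<kappa>_def)
    then show "piece \<kappa> w (Some False) \<noteq> (\<lambda>_. 0)" by auto
  qed
  ultimately show False using min[OF st(3)] by simp
qed

lemma exists_least_energy_solution:
  obtains w where "w \<in> M" "\<And>u. u \<in> M \<Longrightarrow> J w \<le> J u" "\<And>v. v \<in> E \<Longrightarrow> dJ w v = 0" "changes_sign_once w"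
proof -
  obtain w where w: "w \<in> M" and min: "\<And>u. u \<in> M \<Longrightarrow> J w \<le> J u" using exists_minimizer by metis
  have wE: "w \<in> E" using w by (simp add: M_def)
  have "dJ w (\<lambda>n. of_bool (n = k)) = 0" for k
    unfolding dJ_site by (rule minimizer_site_deriv[OF w min])
  from critical_of_sites[OF wE this] have crit: "\<And>v. v \<in> E \<Longrightarrow> dJ w v = 0" .
  obtain i j where "0 < w i" "w j < 0"
    using w unfolding M_def pos_part_nonzero_iff neg_part_nonzero_iff by blast
  then have "changes_sign_once w"
    by (rule no_triple_imp_changes_sign_once) (rule minimizer_no_triple[OF w min crit])
  then show thesis using that w min crit by blast
qed

end

theorem theorem1p1:
  fixes p q r :: real and a b c :: "int \<Rightarrow> real"
  assumes "1 < p" and "p < q" and "\<exists>k::nat. k \<ge> 1 \<and> p / 2 = real k" and "r \<ge> 1"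
    and "\<forall>n. a n > 0" and "\<forall>n. b n > 0" and "\<forall>n. c n > 0"
    and C1: "\<exists>b0>0. \<forall>n. b n \<ge> b0" "filterlim b at_top cofinite"
    and C2: "\<exists>c0>0. \<forall>n. c n \<le> c0" "c summable_on UNIV"
  shows "\<exists>u0. u0 \<in> signNehari p q r a b c \<and> is_solution p q r a b c u0
            \<and> pos_part u0 \<noteq> (\<lambda>_. 0) \<and> neg_part u0 \<noteq> (\<lambda>_. 0)
            \<and> (\<forall>u \<in> signNehari p q r a b c. Ifun p q r a b c u0 \<le> Ifun p q r a b c u)
            \<and> Ifun p q r a b c u0 = (INF u \<in> signNehari p q r a b c. Ifun p q r a b c u)
            \<and> Ifun p q r a b c u0 > 0
            \<and> changes_sign_once u0"
proof -
  obtain k :: nat where k: "k \<ge> 1" "p / 2 = real k" using assms(3) by blast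
  define P where "P = 2 * k"
  have p: "p = real P" using k by (simp add: P_def)
  obtain b0 where b0: "b0 > 0" "\<forall>n. b n \<ge> b0" using C1(1) by blast
  interpret log_laplacian P q r a b c b0
    by standard (use assms k b0 p in \<open>auto simp: P_def\<close>)
  obtain w where w: "w \<in> M" and min: "\<And>u. u \<in> M \<Longrightarrow> J w \<le> J u"
    and crit: "\<And>v. v \<in> E \<Longrightarrow> dJ w v = 0" and once: "changes_sign_once w"
    using exists_least_energy_solution by metis
  have "J w = (INF u\<in>M. J u)"
    using w min by (intro cInf_eq_minimum[symmetric]) auto
  then show ?thesis
    using w min crit once J_pos[OF w]
    by (intro exI[of _ w]) (auto simp: p signNehari_eq Ifun_eq is_solution_def Dspace_eq dI_eq M_def)
qed

end
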